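(* Let $\iota\in[K]$ be an initial colour of an edge iterated graph system satisfying the standing assumptions in the context. For every colour $j\in\mathfrak r_{\mathbf M}(\iota)$ there exists $c_j\in(0,\infty)$ such that \[ \frac{1}{\Lambda_{\mathcal D}(j)^n}\min_{\mathbf D_1,\dots,\mathbf D_n\in\mathcal D}\Big\|\boldsymbol\xi_j\prod_{m=1}^n\mathbf D_m\Big\|_1\longrightarrow c_j\quad(n\to\infty). \] Moreover, there is a constant $c>0$ such that for every $n$ and every sequence $\mathbf D_1,\dots,\mathbf D_n\in\mathcal D$, $\big\|\boldsymbol\xi_j\prod_{m=1}^n\mathbf D_m\big\|_1\ge c\,\Lambda_{\mathcal D}(j)^n$.
   Context: Conventions: $[N]=\{1,\dots,N\}$; $\boldsymbol\xi_j$ is the $j$-th standard basis row vector; $\|\cdot\|_1$ is the $\ell^1$ norm; $\rho$ is spectral radius; distances in directed graphs are undirected graph distances. EIGS: $K\ge1$ colours; for $i\in[K]$, $R_i$ is a finite connected directed graph with edges coloured in $[K]$ and planting vertices $\beta_i^+,\beta_i^-$ with $d_{R_i}(\beta_i^+,\beta_i^-)\ge2$. Mass matrix $\mathbf M$: $[\mathbf M]_{ik}$ = number of colour-$k$ edges of $R_i$. Path matrices: for each $i$ choose a simple path from $\beta_i^+$ to $\beta_i^-$ in the underlying undirected graph of $R_i$; the matrix whose $i$-th row counts, for each colour $k$, the colour-$k$ edges of the chosen path is a path matrix; $\mathcal D$ is the set of all path matrices (rows can be chosen independently). Frobenius notions: for a nonnegative square $\mathbf X$, $i\rightsquigarrow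 k$ iff $[\mathbf X^n]_{ik}>0$ for some $n\ge0$; $\mathfrak r_{\mathbf X}(i)$ = indices reachable from $i$; blocks = mutual-reachability classes with diagonal blocks $\mathbf B_k(\mathbf X)$; $\mathfrak R_{\mathbf X}(i)$ = set of blocks reachable from the block of $i$; primitive-Frobenius = every diagonal block primitive. Standing assumption: $\mathbf M$ and all $\mathbf D\in\mathcal D$ are primitive-Frobenius. Distance rates: $S_j=\bigcup_{\mathbf D\in\mathcal D}\mathfrak r_{\mathbf D}(j)$; $A_j(\mathbf D)$ = principal submatrix of $\mathbf D$ on $S_j$; $\Lambda_{\mathcal D}(j)=\min_{\mathbf D\in\mathcal D}\max_{\ell\in\mathfrak R_{\mathbf D}(j)}\rho(\mathbf B_\ell(\mathbf D))$. Standing assumption (local primitive stability): for every $j\in\mathfrak r_{\mathbf M}(\iota)$ there is $\mathbf D_j^*\in\mathcal D$ with $\rho(A_j(\mathbf D_j^* ))=\Lambda_{\mathcal D}(j)$, $A_j(\mathbf D_j^* )$ primitive, and replacing any one row of $\mathbf D_j^*$ indexed by $S_j$ by the corresponding row of any other matrix in $\mathcal D$ keeps the $S_j$-principal submatrix primitive. *)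

theory Defs
  imports
    "Jordan_Normal_Form.DL_Submatrix"
    "Jordan_Normal_Form.Spectral_Radius"
    "Graph_Theory.Graph_Theory"
begin

section \<open>Edge iterated graph systems\<close>

text \<open>The colours $1, \dots, K$ are represented by $0, \dots, K-1$, matching the indices of the
  matrices of Jordan_Normal_Form. Values of the fields of the record at non-colours are
  irrelevant. The rule graphs may have loops and parallel edges.\<close>

record ('v, 'e) edge_system =
  ncolours :: nat
  rule_graph :: "nat \<Rightarrow> ('v, 'e) pre_digraph"
  edge_colour :: "nat \<Rightarrow> 'e \<Rightarrow> nat"
  planting_plus :: "nat \<Rightarrow> 'v"
  planting_minus :: "nat \<Rightarrow> 'v"

text \<open>The underlying undirected graph: every edge \<open>e\<close> can be traversed forwards, as \<open>(e, True)\<close>, and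
  backwards, as \<open>(e, False)\<close>. Unlike \<open>mk_symmetric\<close>, this keeps parallel and antiparallel edges
  (hence their colours) apart.\<close>

definition underlying :: "('v, 'e) pre_digraph \<Rightarrow> ('v, 'e \<times> bool) pre_digraph" where
  "underlying G = \<lparr> verts = verts G, arcs = arcs G \<times> UNIV,
     tail = (\<lambda>(e, forward). if forward then tail G e else head G e),
     head = (\<lambda>(e, forward). if forward then head G e else tail G e) \<rparr>"

definition undirected_dist :: "('v, 'e) pre_digraph \<Rightarrow> 'v \<Rightarrow> 'v \<Rightarrow> ereal" where
  "undirected_dist G u v = wf_digraph.\<mu> (underlying G) (\<lambda>_. 1) u v"

abbreviation simple_path ::
  "('v, 'e) pre_digraph \<Rightarrow> 'v \<Rightarrow> ('e \<times> bool) list \<Rightarrow> 'v \<Rightarrow> bool" where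
  "simple_path G u p v \<equiv> pre_digraph.apath (underlying G) u p v"

locale eigs =
  fixes E :: "('v, 'e) edge_system"
  assumes ncolours_ge_1: "1 \<le> ncolours E"
    and finite_rule: "i < ncolours E \<Longrightarrow> fin_digraph (rule_graph E i)"
    and connected_rule: "i < ncolours E \<Longrightarrow> connected (rule_graph E i)"
    and colour_less: "i < ncolours E \<Longrightarrow> e \<in> arcs (rule_graph E i) \<Longrightarrow> edge_colour E i e < ncolours E"
    and plus_in_verts: "i < ncolours E \<Longrightarrow> planting_plus E i \<in> verts (rule_graph E i)"
    and minus_in_verts: "i < ncolours E \<Longrightarrow> planting_minus E i \<in> verts (rule_graph E i)"
    and planting_dist: "i < ncolours E \<Longrightarrow>
      2 \<le> undirected_dist (rule_graph E i) (planting_plus E i) (planting_minus E i)"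

definition mass_matrix :: "('v, 'e) edge_system \<Rightarrow> real mat" where
  "mass_matrix E = mat (ncolours E) (ncolours E)
     (\<lambda>(i, k). real (card {e \<in> arcs (rule_graph E i). edge_colour E i e = k}))"

definition path_matrix :: "('v, 'e) edge_system \<Rightarrow> (nat \<Rightarrow> ('e \<times> bool) list) \<Rightarrow> real mat" where
  "path_matrix E p = mat (ncolours E) (ncolours E)
     (\<lambda>(i, k). real (length (filter (\<lambda>(e, _). edge_colour E i e = k) (p i))))"

definition path_matrices :: "('v, 'e) edge_system \<Rightarrow> real mat set" where
  "path_matrices E = {path_matrix E p | p.
     \<forall>i < ncolours E. simple_path (rule_graph E i) (planting_plus E i) (p i) (planting_minus E i)}"


section \<open>Frobenius notions\<close>

text \<open>The exponent is positive, so the $1 \times 1$ zero matrix is not primitive, although reachability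
  below also allows exponent 0.\<close>

definition primitive_mat :: "real mat \<Rightarrow> bool" where
  "primitive_mat X \<longleftrightarrow> square_mat X \<and> (\<forall>i < dim_row X. \<forall>k < dim_row X. 0 \<le> X $$ (i, k)) \<and>
     (\<exists>n \<ge> 1. \<forall>i < dim_row X. \<forall>k < dim_row X. 0 < (X ^\<^sub>m n) $$ (i, k))"

definition reachable_from :: "real mat \<Rightarrow> nat \<Rightarrow> nat set" where
  "reachable_from X i = {k. i < dim_row X \<and> k < dim_row X \<and> (\<exists>n. 0 < (X ^\<^sub>m n) $$ (i, k))}"

definition block_of :: "real mat \<Rightarrow> nat \<Rightarrow> nat set" where
  "block_of X i = {k. k \<in> reachable_from X i \<and> i \<in> reachable_from X k}"

text \<open>A block is represented by its set of indices.\<close>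

definition blocks :: "real mat \<Rightarrow> nat set set" where
  "blocks X = block_of X ` {..<dim_row X}"

definition reachable_blocks :: "real mat \<Rightarrow> nat \<Rightarrow> nat set set" where
  "reachable_blocks X i = {B \<in> blocks X. \<exists>a \<in> block_of X i. \<exists>b \<in> B. b \<in> reachable_from X a}"

abbreviation principal_submatrix :: "real mat \<Rightarrow> nat set \<Rightarrow> real mat" where
  "principal_submatrix X I \<equiv> submatrix X I I"

definition primitive_frobenius :: "real mat \<Rightarrow> bool" where
  "primitive_frobenius X \<longleftrightarrow> (\<forall>B \<in> blocks X. primitive_mat (principal_submatrix X B))"

abbreviation spec_rad :: "real mat \<Rightarrow> real" where
  "spec_rad X \<equiv> spectral_radius (map_mat complex_of_real X)"


section \<open>Distance rates\<close>

definition support_set :: "('v, 'e) edge_system \<Rightarrow> nat \<Rightarrow> nat set" where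
  "support_set E j = (\<Union>D \<in> path_matrices E. reachable_from D j)"

definition distance_rate :: "('v, 'e) edge_system \<Rightarrow> nat \<Rightarrow> real" where
  "distance_rate E j =
     (MIN D \<in> path_matrices E. MAX B \<in> reachable_blocks D j. spec_rad (principal_submatrix D B))"

definition replace_row :: "real mat \<Rightarrow> nat \<Rightarrow> real mat \<Rightarrow> real mat" where
  "replace_row X i Y = mat (dim_row X) (dim_col X) (\<lambda>(r, k). if r = i then Y $$ (r, k) else X $$ (r, k))"

definition locally_primitive_stable :: "('v, 'e) edge_system \<Rightarrow> nat \<Rightarrow> bool" where
  "locally_primitive_stable E i0 \<longleftrightarrow>
     (\<forall>j \<in> reachable_from (mass_matrix E) i0. \<exists>X \<in> path_matrices E.
        spec_rad (principal_submatrix X (support_set E j)) = distance_rate E j \<and>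
        primitive_mat (principal_submatrix X (support_set E j)) \<and>
        (\<forall>i \<in> support_set E j. \<forall>Y \<in> path_matrices E.
           primitive_mat (principal_submatrix (replace_row X i Y) (support_set E j))))"


section \<open>Products of path matrices\<close>

definition l1_norm :: "real vec \<Rightarrow> real" where
  "l1_norm v = (\<Sum>i < dim_vec v. \<bar>v $ i\<bar>)"

definition mat_prod_list :: "nat \<Rightarrow> real mat list \<Rightarrow> real mat" where
  "mat_prod_list K Ds = foldr (*) Ds (1\<^sub>m K)"

text \<open>The row vector $v A$ is the transpose of $A^T v^T$.\<close>

definition row_vec_mult :: "real vec \<Rightarrow> real mat \<Rightarrow> real vec" where
  "row_vec_mult v A = transpose_mat A *\<^sub>v v"

definition product_norm :: "('v, 'e) edge_system \<Rightarrow> nat \<Rightarrow> real mat list \<Rightarrow> real" where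
  "product_norm E j Ds =
     l1_norm (row_vec_mult (unit_vec (ncolours E) j) (mat_prod_list (ncolours E) Ds))"

end

theory Submission
  imports Defs
begin

text \<open>The optimal matrix \<open>X\<close> is primitive on \<open>S\<close>, the support of \<open>j\<close>, so it has a positive
  eigenvector \<open>v\<close> there for \<open>r = \<Lambda>(j)\<close>. Every path matrix satisfies \<open>D v \<ge> r v\<close> on \<open>S\<close>: replacing a
  row of \<open>X\<close> by a violating row of \<open>D\<close> would give a primitive matrix of smaller spectral radius.
  This already yields the lower bound. Because rows are chosen independently, the minimal norm is
  the \<open>j\<close>-th entry of the \<open>n\<close>-th iterate at the vector \<open>1\<close> of the monotone map
  \<open>T w = min\<^sub>D D w\<close>. This map fixes the ray of \<open>v\<close> up to the factor \<open>r\<close> and lies below \<open>X\<close>, whose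
  primitivity contracts the ratios of \<open>T\<^sup>n 1\<close> and \<open>r\<^sup>n v\<close> to a common positive limit.\<close>

section \<open>Nonnegative operators on a finite index set\<close>

text \<open>Kernels act on functions over an arbitrary index set, so that a principal submatrix can
  be handled without renumbering its indices.\<close>

definition act :: "'a set \<Rightarrow> ('a \<Rightarrow> 'a \<Rightarrow> real) \<Rightarrow> ('a \<Rightarrow> real) \<Rightarrow> 'a \<Rightarrow> real" where
  "act S X w i = (\<Sum>k\<in>S. X i k * w k)"

lemma act_scale: "act S X (\<lambda>k. c * w k) i = c * act S X w i"
  unfolding act_def sum_distrib_left by (intro sum.cong) auto

lemma act_mono:
  assumes "\<And>k. k \<in> S \<Longrightarrow> 0 \<le> X i k" "\<And>k. k \<in> S \<Longrightarrow> w k \<le> w' k"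
  shows "act S X w i \<le> act S X w' i"
  unfolding act_def using assms by (intro sum_mono mult_left_mono) auto

lemma act_cong:
  assumes "\<And>k. k \<in> S \<Longrightarrow> w k = w' k"
  shows "act S X w i = act S X w' i"
  unfolding act_def using assms by (intro sum.cong) auto

text \<open>The positive row \<open>B i\<close> weighs every index of \<open>S\<close>, so a gap at
  the single index \<open>l\<close> shows up in coordinate \<open>i\<close>. Primitivity enters the
  Perron arguments in this form.\<close>

lemma act_pos_strict_mono:
  assumes "finite S" "\<And>k. k \<in> S \<Longrightarrow> 0 < B i k" "\<And>k. k \<in> S \<Longrightarrow> w k \<le> w' k"
    "l \<in> S" "w l < w' l"
  shows "act S B w i < act S B w' i"
  unfolding act_def
proof (rule sum_strict_mono_ex1)
  show "\<forall>k\<in>S. B i k * w k \<le> B i k * w' k"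
    using assms by (auto intro!: mult_left_mono simp: less_imp_le)
  show "\<exists>k\<in>S. B i k * w k < B i k * w' k"
    using assms by (intro bexI[of _ l]) auto
qed (use assms in auto)

lemma funpow_act_mono:
  assumes "\<And>i k. i \<in> S \<Longrightarrow> k \<in> S \<Longrightarrow> 0 \<le> X i k" "\<And>k. k \<in> S \<Longrightarrow> w k \<le> w' k" "i \<in> S"
  shows "(act S X ^^ n) w i \<le> (act S X ^^ n) w' i"
  using assms(3)
proof (induction n arbitrary: i)
  case (Suc n)
  show ?case using Suc assms(1) by (auto intro!: act_mono)
qed (use assms in auto)

text \<open>Multiplying the hypothesis by \<open>r ^ n\<close> and using monotonicity advances the
  induction, whatever the signs of \<open>y\<close>.\<close>

lemma funpow_act_ge:
  assumes "\<And>i k. i \<in> S \<Longrightarrow> k \<in> S \<Longrightarrow> 0 \<le> X i k" "0 \<le> r"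
    "\<And>i. i \<in> S \<Longrightarrow> r * y i \<le> act S X y i" "i \<in> S"
  shows "r ^ n * y i \<le> (act S X ^^ n) y i"
  using assms(4)
proof (induction n arbitrary: i)
  case (Suc n)
  have "r ^ Suc n * y i \<le> r ^ n * act S X y i"
    using mult_left_mono[OF assms(3)[OF Suc.prems], of "r ^ n"] assms(2) by (simp add: mult_ac)
  also have "\<dots> = act S X (\<lambda>k. r ^ n * y k) i" by (simp add: act_scale)
  also have "\<dots> \<le> act S X ((act S X ^^ n) y) i"
    using Suc assms(1) by (intro act_mono) auto
  finally show ?case by simp
qed simp

lemma funpow_act_le:
  assumes "\<And>i k. i \<in> S \<Longrightarrow> k \<in> S \<Longrightarrow> 0 \<le> X i k" "0 \<le> r"
    "\<And>i. i \<in> S \<Longrightarrow> act S X y i \<le> r * y i" "i \<in> S"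
  shows "(act S X ^^ n) y i \<le> r ^ n * y i"
  using assms(4)
proof (induction n arbitrary: i)
  case (Suc n)
  have "act S X ((act S X ^^ n) y) i \<le> act S X (\<lambda>k. r ^ n * y k) i"
    using Suc assms(1) by (intro act_mono) auto
  also have "\<dots> = r ^ n * act S X y i" by (simp add: act_scale)
  also have "\<dots> \<le> r ^ Suc n * y i"
    using mult_left_mono[OF assms(3)[OF Suc.prems], of "r ^ n"] assms(2) by (simp add: mult_ac)
  finally show ?case by simp
qed simp

text \<open>The iterate \<open>X\<^sup>m\<close> is represented by a strictly positive kernel \<open>B\<close>.\<close>

definition eventually_positive :: "'a set \<Rightarrow> ('a \<Rightarrow> 'a \<Rightarrow> real) \<Rightarrow> nat \<Rightarrow> ('a \<Rightarrow> 'a \<Rightarrow> real) \<Rightarrow> bool" where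
  "eventually_positive S X m B \<longleftrightarrow> finite S \<and> (\<forall>i\<in>S. \<forall>k\<in>S. 0 \<le> X i k) \<and> 1 \<le> m \<and>
     (\<forall>i\<in>S. \<forall>k\<in>S. 0 < B i k) \<and> (\<forall>w. \<forall>i\<in>S. (act S X ^^ m) w i = act S B w i)"

section \<open>Eigenvalues against sub- and superinvariant vectors\<close>

text \<open>The triangle inequality makes the modulus of an eigenvector superinvariant for the
  modulus of its eigenvalue.\<close>

lemma norm_eigenvector_le:
  fixes x :: "'a \<Rightarrow> complex"
  assumes "\<And>k. k \<in> S \<Longrightarrow> 0 \<le> X i k"
    and "(\<Sum>k\<in>S. complex_of_real (X i k) * x k) = \<mu> * x i"
  shows "norm \<mu> * norm (x i) \<le> act S X (\<lambda>k. norm (x k)) i"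
proof -
  have "norm \<mu> * norm (x i) = norm (\<Sum>k\<in>S. complex_of_real (X i k) * x k)"
    using assms(2) by (simp add: norm_mult)
  also have "\<dots> \<le> (\<Sum>k\<in>S. norm (complex_of_real (X i k) * x k))" by (rule norm_sum)
  also have "\<dots> = act S X (\<lambda>k. norm (x k)) i"
    unfolding act_def using assms(1) by (intro sum.cong) (auto simp: norm_mult)
  finally show ?thesis .
qed

text \<open>The modulus of the eigenvector is compared with the smallest multiple of
  \<open>v\<close> above it. Where the two touch, one application of \<open>X\<close> brings in the
  gap at \<open>l\<close> and the positive power spreads that gap to the touching index.\<close>

lemma eigenvalue_less_of_strictly_subinvariant:
  fixes x :: "'a \<Rightarrow> complex"
  assumes B: "eventually_positive S X m B"
    and x: "\<And>i. i \<in> S \<Longrightarrow> (\<Sum>k\<in>S. complex_of_real (X i k) * x k) = \<mu> * x i"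
    and nz: "\<exists>i\<in>S. x i \<noteq> 0"
    and v: "\<And>i. i \<in> S \<Longrightarrow> 0 < v i"
    and le: "\<And>i. i \<in> S \<Longrightarrow> act S X v i \<le> r * v i"
    and strict: "l \<in> S" "act S X v l < r * v l"
  shows "norm \<mu> < r"
proof -
  have fin: "finite S" and X: "\<And>i k. i \<in> S \<Longrightarrow> k \<in> S \<Longrightarrow> 0 \<le> X i k"
    and Bpos: "\<And>i k. i \<in> S \<Longrightarrow> k \<in> S \<Longrightarrow> 0 < B i k"
    and Bpow: "\<And>w i. i \<in> S \<Longrightarrow> (act S X ^^ m) w i = act S B w i"
    using B unfolding eventually_positive_def by auto
  define y where "y k = norm (x k)" for k
  \<comment> \<open>\<open>t * v\<close> is the least multiple of \<open>v\<close> dominating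
    \<open>y\<close>; the two agree at the maximising index \<open>a\<close>.\<close>
  define t where "t = Max ((\<lambda>i. y i / v i) ` S)"
  have ne: "S \<noteq> {}" using strict by auto
  have "t \<in> (\<lambda>i. y i / v i) ` S" unfolding t_def using fin ne by (intro Max_in) auto
  then obtain a where a: "a \<in> S" "t = y a / v a" by auto
  have yt: "y i \<le> t * v i" if "i \<in> S" for i
  proof -
    have "y i / v i \<le> t" unfolding t_def using fin that by auto
    thus ?thesis using v[OF that] by (simp add: field_simps)
  qed
  have t: "0 < t"
  proof -
    obtain i where i: "i \<in> S" "x i \<noteq> 0" using nz by auto
    hence "0 < t * v i" using yt[OF i(1)] by (simp add: y_def) (meson less_le_trans zero_less_norm_iff)
    thus ?thesis using v[OF i(1)] by (simp add: zero_less_mult_iff)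
  qed
  have r: "0 < r"
  proof -
    have "0 \<le> act S X v l" unfolding act_def using X v strict(1)
      by (intro sum_nonneg mult_nonneg_nonneg) (auto simp: less_imp_le)
    thus ?thesis using strict v[OF strict(1)] by (smt (verit) zero_less_mult_iff)
  qed
  have sub: "norm \<mu> * y i \<le> act S X y i" if "i \<in> S" for i
    unfolding y_def using norm_eigenvector_le[of S X i x \<mu>] X x that by auto
  \<comment> \<open>The extra factor \<open>X\<close> comes first and supplies strictness at
    \<open>l\<close>; the remaining \<open>m\<close> factors form the positive kernel
    \<open>B\<close>.\<close>
  have "norm \<mu> ^ Suc m * y a \<le> (act S X ^^ Suc m) y a"
    by (rule funpow_act_ge) (use X sub a in auto)
  also have "\<dots> \<le> (act S X ^^ Suc m) (\<lambda>k. t * v k) a"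
    by (rule funpow_act_mono) (use X yt a in auto)
  also have "\<dots> = act S B (act S X (\<lambda>k. t * v k)) a"
    unfolding funpow_Suc_right comp_def by (rule Bpow[OF a(1)])
  also have "\<dots> = act S B (\<lambda>k. t * act S X v k) a"
    by (rule act_cong) (simp add: act_scale)
  also have "\<dots> < act S B (\<lambda>k. t * (r * v k)) a"
    by (rule act_pos_strict_mono[where l = l]) (use fin Bpos a(1) le t strict in auto)
  also have "\<dots> = t * (r * (act S X ^^ m) v a)"
    unfolding act_scale Bpow[OF a(1)] ..
  also have "\<dots> \<le> t * (r * (r ^ m * v a))"
    by (intro mult_left_mono funpow_act_le) (use X r t a le in auto)
  also have "\<dots> = r ^ Suc m * y a" using a v[OF a(1)] by (simp add: field_simps)
  finally have "norm \<mu> ^ Suc m < r ^ Suc m"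
    by (simp add: y_def mult_less_cancel_right)
  thus ?thesis using r by (meson power_less_imp_less_base less_imp_le)
qed

text \<open>The modulus of an eigenvector for an extremal eigenvalue is superinvariant; if it were not
  invariant, applying the positive power would produce a positive vector growing faster than
  \<open>\<rho>\<close>.\<close>

lemma perron_of_extremal_eigenvector:
  fixes x :: "'a \<Rightarrow> complex"
  assumes B: "eventually_positive S X m B"
    and x: "\<And>i. i \<in> S \<Longrightarrow> (\<Sum>k\<in>S. complex_of_real (X i k) * x k) = \<mu> * x i"
    and nz: "\<exists>i\<in>S. x i \<noteq> 0"
    and \<rho>: "norm \<mu> = \<rho>"
    and growth: "\<And>r z. \<rho> < r \<Longrightarrow> (\<And>i. i \<in> S \<Longrightarrow> 0 < z i) \<Longrightarrow>
      (\<And>i. i \<in> S \<Longrightarrow> r * z i \<le> act S X z i) \<Longrightarrow> False"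
  shows "0 < \<rho>" and "\<exists>v. (\<forall>i\<in>S. 0 < v i) \<and> (\<forall>i\<in>S. act S X v i = \<rho> * v i)"
proof -
  have fin: "finite S" and X: "\<And>i k. i \<in> S \<Longrightarrow> k \<in> S \<Longrightarrow> 0 \<le> X i k" and m: "1 \<le> m"
    and Bpos: "\<And>i k. i \<in> S \<Longrightarrow> k \<in> S \<Longrightarrow> 0 < B i k"
    and Bpow: "\<And>w i. i \<in> S \<Longrightarrow> (act S X ^^ m) w i = act S B w i"
    using B unfolding eventually_positive_def by auto
  define y where "y k = norm (x k)" for k
  obtain j where j: "j \<in> S" "0 < y j" using nz unfolding y_def by auto
  have \<rho>0: "0 \<le> \<rho>" using \<rho> by auto
  have sub: "\<rho> * y i \<le> act S X y i" if "i \<in> S" for i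
    unfolding y_def \<rho>[symmetric] using norm_eigenvector_le[of S X i x \<mu>] X x that by auto
  \<comment> \<open>One nonzero entry of \<open>y\<close> suffices for \<open>B\<close> to give a
    positive value everywhere on \<open>S\<close>.\<close>
  have By: "0 < act S B y i" if "i \<in> S" for i
    using act_pos_strict_mono[of S B i "\<lambda>_. 0" y j] fin Bpos that j
    by (auto simp: y_def act_def)
  have eq: "act S X y i = \<rho> * y i" if i: "i \<in> S" for i
  proof (rule ccontr)
    assume "act S X y i \<noteq> \<rho> * y i"
    hence less: "\<rho> * y i < act S X y i" using sub[OF i] by simp
    \<comment> \<open>Since \<open>X\<close> commutes with its own power, the gap of
      \<open>y\<close> at \<open>i\<close> becomes a gap of \<open>z\<close> at every index.\<close>
    define z where "z = (act S X ^^ m) y"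
    have z: "0 < z k" if "k \<in> S" for k using By[OF that] Bpow[OF that] by (simp add: z_def)
    have zX: "\<rho> * z k < act S X z k" if k: "k \<in> S" for k
    proof -
      have "\<rho> * z k = act S B (\<lambda>k. \<rho> * y k) k" by (simp add: z_def act_scale Bpow[OF k])
      also have "\<dots> < act S B (act S X y) k"
        by (rule act_pos_strict_mono[where l = i]) (use fin Bpos k i less sub in auto)
      also have "\<dots> = (act S X ^^ m) (act S X y) k" using Bpow[OF k] by simp
      also have "\<dots> = act S X z k" unfolding z_def by (simp flip: funpow_swap1)
      finally show ?thesis .
    qed
    \<comment> \<open>The least ratio exceeds \<rho> because \<open>S\<close> is finite, and it is a
      growth factor excluded by \<open>growth\<close>.\<close>
    define r where "r = Min ((\<lambda>k. act S X z k / z k) ` S)"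
    have "\<rho> < r" unfolding r_def using fin i z zX by (subst Min_gr_iff) (auto simp: field_simps)
    moreover have "r * z k \<le> act S X z k" if k: "k \<in> S" for k
    proof -
      have "r \<le> act S X z k / z k" unfolding r_def using fin k by auto
      thus ?thesis using z[OF k] by (simp add: field_simps)
    qed
    ultimately show False using growth z by blast
  qed
  \<comment> \<open>With \<open>y\<close> invariant, \<open>B\<close> multiplies it by
    \<open>\<rho> ^ m\<close>; positivity of the image makes both \<rho> and every entry of
    \<open>y\<close> positive.\<close>
  have "act S B y i = \<rho> ^ m * y i" if i: "i \<in> S" for i
    unfolding Bpow[OF i, symmetric]
    by (intro antisym funpow_act_le funpow_act_ge) (use X \<rho>0 eq i in auto)
  hence pos: "0 < \<rho> ^ m * y i" if "i \<in> S" for i using By that by metis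
  \<comment> \<open>The exponent \<open>m\<close> has to be positive: the zeroth power of \<rho>
    would be positive for \<rho> = 0 as well.\<close>
  show "0 < \<rho>" using pos[OF j(1)] m \<rho>0 j by (auto simp: zero_less_mult_iff zero_less_power_eq less_le)
  show "\<exists>v. (\<forall>i\<in>S. 0 < v i) \<and> (\<forall>i\<in>S. act S X v i = \<rho> * v i)"
  proof (intro exI conjI ballI)
    show "0 < y i" if "i \<in> S" for i
      using pos[OF that] by (auto simp: y_def zero_less_mult_iff)
  qed (rule eq)
qed

section \<open>Convergence of the normalised iterates\<close>

text \<open>Let \<open>M n\<close> and \<open>\<mu> n\<close> be the maximum and minimum over \<open>S\<close> of the ratios of
  \<open>T\<^sup>n 1\<close> and \<open>r\<^sup>n v\<close>. The positive power of the dominating linear operator pulls every ratio below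
  \<open>M n\<close> by a fixed fraction of \<open>M n - \<mu> n\<close>, so the bounded monotone sequence \<open>M\<close> forces
  \<open>M n - \<mu> n\<close> to vanish.\<close>

lemma normalised_iterates_tendsto:
  fixes T :: "('a \<Rightarrow> real) \<Rightarrow> 'a \<Rightarrow> real"
  assumes B: "eventually_positive S X m B" and ne: "S \<noteq> {}"
    and mono: "\<And>w w' i. (\<And>k. k \<in> S \<Longrightarrow> w k \<le> w' k) \<Longrightarrow> i \<in> S \<Longrightarrow> T w i \<le> T w' i"
    and T_v: "\<And>a i. 0 \<le> a \<Longrightarrow> i \<in> S \<Longrightarrow> T (\<lambda>k. a * v k) i = a * r * v i"
    and T_le: "\<And>w i. i \<in> S \<Longrightarrow> T w i \<le> act S X w i"
    and v: "\<And>i. i \<in> S \<Longrightarrow> 0 < v i" and Xv: "\<And>i. i \<in> S \<Longrightarrow> act S X v i = r * v i"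
    and r: "0 < r"
  shows "\<exists>c>0. \<forall>i\<in>S. (\<lambda>n. (T ^^ n) (\<lambda>_. 1) i / r ^ n) \<longlonglongrightarrow> c * v i"
    and "\<exists>c>0. \<forall>n. \<forall>i\<in>S. c * r ^ n \<le> (T ^^ n) (\<lambda>_. 1) i"
proof -
  have fin: "finite S" and X: "\<And>i k. i \<in> S \<Longrightarrow> k \<in> S \<Longrightarrow> 0 \<le> X i k"
    and Bpos: "\<And>i k. i \<in> S \<Longrightarrow> k \<in> S \<Longrightarrow> 0 < B i k"
    and Bpow: "\<And>w i. i \<in> S \<Longrightarrow> (act S X ^^ m) w i = act S B w i"
    using B unfolding eventually_positive_def by auto
  define w where "w n = (T ^^ n) (\<lambda>_. 1)" for n
  define u where "u n i = w n i / (r ^ n * v i)" for n i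
  define M where "M n = Max (u n ` S)" for n
  define \<mu> where "\<mu> n = Min (u n ` S)" for n
  have w_u: "w n i = u n i * r ^ n * v i" if "i \<in> S" for n i
    using v[OF that] r by (simp add: u_def)
  have rv: "0 < r ^ n * v i" if "i \<in> S" for n i using v[OF that] r by simp
  have uM: "u n i \<le> M n" and \<mu>u: "\<mu> n \<le> u n i" if "i \<in> S" for n i
    using fin that by (auto simp: M_def \<mu>_def)
  have w_Suc: "w (Suc n) = T (w n)" for n by (simp add: w_def)
  have \<mu>0: "0 < \<mu> 0" unfolding \<mu>_def using fin ne v by (auto simp: u_def w_def)
  \<comment> \<open>\<open>T\<close> is known to scale \<open>v\<close> only for nonnegative
    factors, so positivity of the minimum ratio is carried along the induction.\<close>
  have \<mu>_step: "\<mu> n \<le> \<mu> (Suc n)" if n: "0 < \<mu> n" for n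
  proof -
    have "\<mu> n \<le> u (Suc n) i" if i: "i \<in> S" for i
    proof -
      have "\<mu> n * r ^ Suc n * v i = T (\<lambda>k. \<mu> n * r ^ n * v k) i"
        using T_v[of "\<mu> n * r ^ n" i] n r i by simp
      also have "\<dots> \<le> T (w n) i"
        by (rule mono) (use i \<mu>u r v in \<open>auto simp: w_u less_imp_le intro!: mult_right_mono\<close>)
      finally show ?thesis using rv[OF i, of "Suc n"]
        by (simp add: u_def w_Suc pos_le_divide_eq mult.assoc)
    qed
    thus ?thesis unfolding \<mu>_def[of "Suc n"] using fin ne by auto
  qed
  have \<mu>_ge: "\<mu> 0 \<le> \<mu> n" for n
    by (induction n) (use \<mu>0 \<mu>_step in \<open>auto intro: order_trans less_le_trans\<close>)
  have upos: "0 < u n i" if "i \<in> S" for n i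
    using \<mu>0 \<mu>_ge[of n] \<mu>u[OF that, of n] by linarith
  have M_pos: "\<mu> 0 \<le> M n" for n
    using ne uM \<mu>u \<mu>_ge[of n] by (meson all_not_in_conv order_trans)
  have M_step: "M (Suc n) \<le> M n" for n
  proof -
    have "u (Suc n) i \<le> M n" if i: "i \<in> S" for i
    proof -
      have "T (w n) i \<le> T (\<lambda>k. M n * r ^ n * v k) i"
        by (rule mono) (use i uM r v in \<open>auto simp: w_u less_imp_le intro!: mult_right_mono\<close>)
      also have "\<dots> = M n * r ^ Suc n * v i"
        using T_v[of "M n * r ^ n" i] M_pos[of n] \<mu>0 r i by simp
      finally show ?thesis using rv[OF i, of "Suc n"]
        by (simp add: u_def w_Suc pos_divide_le_eq mult.assoc)
    qed
    thus ?thesis unfolding M_def[of "Suc n"] using fin ne by auto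
  qed
  have "decseq M" using M_step by (rule decseq_SucI)
  then obtain L where L: "M \<longlonglongrightarrow> L"
    using decseq_convergent[of M "\<mu> 0"] M_pos by blast
  have "\<mu> 0 \<le> L" using L M_pos by (intro LIMSEQ_le_const) auto
  hence L0: "0 < L" using \<mu>0 by linarith
  \<comment> \<open>Comparison with the linear operator: from time \<open>n\<close> on, the iterates
    of \<open>T\<close> stay below those of \<open>X\<close>.\<close>
  have w_le: "w (n + k) i \<le> (act S X ^^ k) (w n) i" if "i \<in> S" for n k i
    using that
  proof (induction k arbitrary: i)
    case (Suc k)
    have "w (n + Suc k) i \<le> act S X (w (n + k)) i" using T_le Suc.prems by (simp add: w_Suc)
    also have "\<dots> \<le> act S X ((act S X ^^ k) (w n)) i"
      using Suc X by (intro act_mono) auto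
    finally show ?case by simp
  qed simp
  have Bv: "act S B v i = r ^ m * v i" if i: "i \<in> S" for i
    unfolding Bpow[OF i, symmetric]
    by (intro antisym funpow_act_le funpow_act_ge) (use X Xv r i in auto)
  \<comment> \<open>\<delta> is the least share that a single index \<open>l\<close> contributes to
    \<open>r ^ m * v i\<close>, the value of \<open>B\<close> on \<open>v\<close>.\<close>
  define \<delta> where "\<delta> = Min ((\<lambda>(i, l). B i l * v l / (r ^ m * v i)) ` (S \<times> S))"
  have \<delta>0: "0 < \<delta>" unfolding \<delta>_def using fin ne v Bpos r by (auto simp: Min_gr_iff)
  have \<delta>_le: "\<delta> * (r ^ m * v i) \<le> B i l * v l" if "i \<in> S" "l \<in> S" for i l
  proof -
    have "\<delta> \<le> B i l * v l / (r ^ m * v i)" unfolding \<delta>_def using fin that by (intro Min_le) auto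
    thus ?thesis using rv[OF that(1), of m] by (simp add: pos_le_divide_eq)
  qed
  \<comment> \<open>The deficit \<open>M n * r ^ n * v k - w n k\<close> is nonnegative, and at the
    index \<open>l\<close> of the minimal ratio it is \<open>(M n - \<mu> n) * r ^ n * v l\<close>.
    Its image under \<open>B\<close> is then at least
    \<open>\<delta> * (M n - \<mu> n) * r ^ (n + m) * v i\<close> at every \<open>i\<close>.\<close>
  have contract: "M (n + m) \<le> M n - \<delta> * (M n - \<mu> n)" for n
  proof -
    have "\<mu> n \<in> u n ` S" unfolding \<mu>_def using fin ne by (intro Min_in) auto
    then obtain l where l: "l \<in> S" "\<mu> n = u n l" by auto
    have "u (n + m) i \<le> M n - \<delta> * (M n - \<mu> n)" if i: "i \<in> S" for i
    proof -
      have "\<delta> * (r ^ m * v i) * ((M n - \<mu> n) * r ^ n) \<le> B i l * v l * ((M n - \<mu> n) * r ^ n)"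
        using \<delta>_le[OF i l(1)] uM[OF l(1), of n] r l(2) by (intro mult_right_mono) auto
      also have "\<dots> = B i l * (M n * r ^ n * v l - w n l)"
        by (simp add: w_u[OF l(1)] l(2) algebra_simps)
      also have "\<dots> \<le> (\<Sum>k\<in>S. B i k * (M n * r ^ n * v k - w n k))"
      proof (rule member_le_sum[OF l(1) _ fin])
        fix k assume "k \<in> S - {l}"
        thus "0 \<le> B i k * (M n * r ^ n * v k - w n k)"
          using Bpos[OF i, of k] uM[of k n] r v[of k]
          by (auto simp: w_u less_imp_le intro!: mult_nonneg_nonneg mult_right_mono)
      qed
      also have "\<dots> = act S B (\<lambda>k. M n * r ^ n * v k) i - act S B (w n) i"
        unfolding act_def by (simp add: right_diff_distrib sum_subtractf)
      also have "\<dots> = M n * r ^ n * (r ^ m * v i) - (act S X ^^ m) (w n) i"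
        by (simp add: act_scale Bv[OF i] Bpow[OF i])
      also have "\<dots> \<le> M n * r ^ n * (r ^ m * v i) - w (n + m) i"
        using w_le[OF i] by simp
      finally have "w (n + m) i \<le> (M n - \<delta> * (M n - \<mu> n)) * (r ^ (n + m) * v i)"
        by (simp add: algebra_simps power_add)
      thus ?thesis using rv[OF i, of "n + m"] by (simp add: u_def pos_divide_le_eq)
    qed
    thus ?thesis unfolding M_def[of "n + m"] using fin ne by auto
  qed
  \<comment> \<open>Solving the contraction for the minimum ratio gives a lower bound for
    \<open>u n i\<close> that, like the upper bound \<open>M n\<close>, tends to
    \<open>L\<close>.\<close>
  have gap: "(\<lambda>n. M n - (M n - M (n + m)) / \<delta>) \<longlonglongrightarrow> L - (L - L) / \<delta>"
    by (intro tendsto_intros L LIMSEQ_ignore_initial_segment[OF L]) (use \<delta>0 in auto)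
  have lim: "(\<lambda>n. u n i) \<longlonglongrightarrow> L" if i: "i \<in> S" for i
  proof (rule tendsto_sandwich[OF _ _ gap[simplified] L])
    show "\<forall>\<^sub>F n in sequentially. M n - (M n - M (n + m)) / \<delta> \<le> u n i"
    proof (intro always_eventually allI)
      fix n
      have "M n - \<mu> n \<le> (M n - M (n + m)) / \<delta>"
        using contract[of n] \<delta>0 by (simp add: pos_le_divide_eq mult.commute)
      thus "M n - (M n - M (n + m)) / \<delta> \<le> u n i" using \<mu>u[OF i, of n] by linarith
    qed
    show "\<forall>\<^sub>F n in sequentially. u n i \<le> M n" using uM[OF i] by simp
  qed
  show "\<exists>c>0. \<forall>i\<in>S. (\<lambda>n. (T ^^ n) (\<lambda>_. 1) i / r ^ n) \<longlonglongrightarrow> c * v i"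
  proof (intro exI conjI ballI)
    fix i assume i: "i \<in> S"
    have "(\<lambda>n. u n i * v i) \<longlonglongrightarrow> L * v i" by (intro tendsto_intros lim i)
    thus "(\<lambda>n. (T ^^ n) (\<lambda>_. 1) i / r ^ n) \<longlonglongrightarrow> L * v i"
      using v[OF i] by (simp add: u_def w_def)
  qed (rule L0)
  show "\<exists>c>0. \<forall>n. \<forall>i\<in>S. c * r ^ n \<le> (T ^^ n) (\<lambda>_. 1) i"
  proof (intro exI conjI allI ballI)
    \<comment> \<open>The smallest entry of \<open>v\<close> turns the uniform bound
      \<open>\<mu> 0\<close> on the ratios into one on the iterates.\<close>
    show "0 < \<mu> 0 * Min (v ` S)" using \<mu>0 fin ne v by auto
    fix n i assume i: "i \<in> S"
    have "Min (v ` S) \<le> v i" using fin i by (intro Min_le) auto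
    moreover have "\<mu> 0 \<le> u n i" using \<mu>_ge[of n] \<mu>u[OF i, of n] by linarith
    ultimately have "\<mu> 0 * Min (v ` S) \<le> u n i * v i"
      using \<mu>0 v[OF i] upos[OF i, of n] by (smt (verit) mult_left_mono mult_right_mono)
    hence "\<mu> 0 * Min (v ` S) * r ^ n \<le> u n i * v i * r ^ n"
      using r by (intro mult_right_mono) auto
    thus "\<mu> 0 * Min (v ` S) * r ^ n \<le> (T ^^ n) (\<lambda>_. 1) i"
      using w_u[OF i, of n] by (simp add: w_def mult_ac)
  qed
qed

section \<open>Primitive matrices\<close>

lemma index_mult_mat_sum:
  assumes "A \<in> carrier_mat n n" "B \<in> carrier_mat n n" "i < n" "j < n"
  shows "(A * B) $$ (i, j) = (\<Sum>k<n. A $$ (i, k) * B $$ (k, j))"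
  using assms by (auto simp: scalar_prod_def atLeast0LessThan intro!: sum.cong)

lemma index_pow_mat_Suc:
  assumes "A \<in> carrier_mat n n" "i < n" "j < n"
  shows "(A ^\<^sub>m Suc m) $$ (i, j) = (\<Sum>k<n. (A ^\<^sub>m m) $$ (i, k) * A $$ (k, j))"
  using index_mult_mat_sum[OF pow_carrier_mat[OF assms(1)] assms(1)] assms by simp

lemma funpow_act_mat:
  assumes "A \<in> carrier_mat n n" "i < n"
  shows "(act {..<n} (\<lambda>i k. A $$ (i, k)) ^^ m) w i = act {..<n} (\<lambda>i k. (A ^\<^sub>m m) $$ (i, k)) w i"
proof (induction m arbitrary: w)
  case 0
  have "(\<Sum>k<n. (1\<^sub>m n) $$ (i, k) * w k) = (\<Sum>k<n. if i = k then w k else 0)"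
    using assms by (intro sum.cong) auto
  thus ?case using assms by (simp add: act_def)
next
  case (Suc m)
  \<comment> \<open>\<open>pow_mat\<close> appends factors on the right, so the innermost
    application of the operator is peeled off; \<open>w\<close> varies in the induction for this
    reason.\<close>
  have "(act {..<n} (\<lambda>i k. A $$ (i, k)) ^^ Suc m) w i =
      (\<Sum>l<n. (A ^\<^sub>m m) $$ (i, l) * (\<Sum>k<n. A $$ (l, k) * w k))"
    unfolding funpow_Suc_right comp_def Suc.IH by (simp add: act_def)
  also have "\<dots> = (\<Sum>k<n. \<Sum>l<n. (A ^\<^sub>m m) $$ (i, l) * A $$ (l, k) * w k)"
    unfolding sum_distrib_left by (subst sum.swap) (simp add: mult.assoc)
  also have "\<dots> = act {..<n} (\<lambda>i k. (A ^\<^sub>m Suc m) $$ (i, k)) w i"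
    unfolding act_def sum_distrib_right[symmetric]
    by (intro sum.cong refl) (simp add: index_pow_mat_Suc[OF assms] del: pow_mat.simps)
  finally show ?case .
qed

lemma primitive_mat_eventually_positive:
  assumes "A \<in> carrier_mat n n" "primitive_mat A"
  obtains m where "eventually_positive {..<n} (\<lambda>i k. A $$ (i, k)) m (\<lambda>i k. (A ^\<^sub>m m) $$ (i, k))"
proof -
  obtain m where "1 \<le> m" "\<And>i k. i < n \<Longrightarrow> k < n \<Longrightarrow> 0 < (A ^\<^sub>m m) $$ (i, k)"
    and "\<And>i k. i < n \<Longrightarrow> k < n \<Longrightarrow> 0 \<le> A $$ (i, k)"
    using assms unfolding primitive_mat_def by auto
  thus ?thesis using assms(1)
    by (intro that[of m]) (auto simp: eventually_positive_def funpow_act_mat)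
qed

section \<open>Spectral radius of nonnegative and primitive matrices\<close>

lemma eigenvalue_sum:
  assumes "A \<in> carrier_mat n n" "eigenvalue (map_mat complex_of_real A) \<mu>"
  obtains x where "\<And>i. i < n \<Longrightarrow> (\<Sum>k<n. complex_of_real (A $$ (i, k)) * x k) = \<mu> * x i"
    and "\<exists>i<n. x i \<noteq> 0"
proof -
  let ?C = "map_mat complex_of_real A"
  obtain xv where xv: "xv \<in> carrier_vec n" "xv \<noteq> 0\<^sub>v n" "?C *\<^sub>v xv = \<mu> \<cdot>\<^sub>v xv"
    using assms unfolding eigenvalue_def eigenvector_def by auto
  have "(\<Sum>k<n. complex_of_real (A $$ (i, k)) * xv $ k) = \<mu> * xv $ i" if "i < n" for i
  proof -
    have "(\<Sum>k<n. complex_of_real (A $$ (i, k)) * xv $ k) = (?C *\<^sub>v xv) $ i"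
      using assms(1) xv(1) that by (auto simp: scalar_prod_def atLeast0LessThan intro!: sum.cong)
    thus ?thesis using xv that by simp
  qed
  moreover have "\<exists>i<n. xv $ i \<noteq> 0"
    using xv(1,2) by (metis carrier_vecD eq_vecI index_zero_vec)
  ultimately show ?thesis by (rule that)
qed

lemma spectral_radius_eigenvalue:
  assumes "A \<in> carrier_mat n n" "0 < n"
  obtains \<mu> where "eigenvalue A \<mu>" "norm \<mu> = spectral_radius A"
  using spectral_radius_mem_max(1)[OF assms] by (auto simp: spectrum_def)

text \<open>If \<open>r\<close> were larger, scaling by some \<open>q\<close> strictly in between
  would give a matrix of spectral radius below 1, hence with bounded powers, so the entries of
  \<open>A ^\<^sub>m k\<close> would be at most a constant times \<open>q ^ k\<close>. Yet
  \<open>z\<close> forces growth of order \<open>r ^ k\<close>.\<close>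

lemma superinvariant_growth_le_spec_rad:
  assumes A: "A \<in> carrier_mat n n" and n: "0 < n"
    and nonneg: "\<And>i k. i < n \<Longrightarrow> k < n \<Longrightarrow> 0 \<le> A $$ (i, k)"
    and z: "\<And>i. i < n \<Longrightarrow> 0 < z i"
    and ge: "\<And>i. i < n \<Longrightarrow> r * z i \<le> act {..<n} (\<lambda>i k. A $$ (i, k)) z i"
  shows "r \<le> spec_rad A"
proof (rule ccontr)
  assume "\<not> r \<le> spec_rad A"
  then obtain q where q: "spec_rad A < q" "q < r" using dense[of "spec_rad A" r] by auto
  let ?C = "map_mat complex_of_real A"
  have C: "?C \<in> carrier_mat n n" using A by simp
  have "0 \<le> spec_rad A" using spectral_radius_eigenvalue[OF C n] by (metis norm_ge_zero)
  hence q0: "0 < q" using q by simp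
  define D where "D = map_mat complex_of_real ((1 / q) \<cdot>\<^sub>m A)"
  have D: "D \<in> carrier_mat n n" using A by (simp add: D_def)
  have "spectral_radius D < 1"
  proof -
    obtain \<mu> where \<mu>: "eigenvalue D \<mu>" "norm \<mu> = spectral_radius D"
      by (rule spectral_radius_eigenvalue[OF D n])
    obtain x where x: "x \<in> carrier_vec n" "x \<noteq> 0\<^sub>v n" "D *\<^sub>v x = \<mu> \<cdot>\<^sub>v x"
      using \<mu>(1) D unfolding eigenvalue_def eigenvector_def by auto
    \<comment> \<open>Eigenvalues of \<open>D\<close> are brought back to eigenvalues of
      \<open>A\<close> through the factor \<open>q\<close>.\<close>
    have CD: "?C = complex_of_real q \<cdot>\<^sub>m D"
      using A q0 by (intro eq_matI) (auto simp: D_def)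
    have "?C *\<^sub>v x = complex_of_real q \<cdot>\<^sub>v (D *\<^sub>v x)"
      unfolding CD using D x(1) by (intro eq_vecI) (auto simp: scalar_prod_def sum_distrib_left mult.assoc)
    hence "?C *\<^sub>v x = (complex_of_real q * \<mu>) \<cdot>\<^sub>v x"
      unfolding x(3) by (simp add: smult_smult_assoc)
    hence "eigenvalue ?C (complex_of_real q * \<mu>)"
      using x A unfolding eigenvalue_def eigenvector_def by auto
    hence "norm (complex_of_real q * \<mu>) \<le> spec_rad A"
      by (intro spectral_radius_mem_max(2)[OF C n]) (auto simp: spectrum_def)
    hence "q * norm \<mu> \<le> spec_rad A" using q0 by (simp add: norm_mult)
    hence "q * norm \<mu> < q * 1" using q by linarith
    hence "norm \<mu> < 1" using q0 by (simp only: mult_less_cancel_left_pos)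
    thus ?thesis by (simp add: \<mu>(2))
  qed
  then obtain c where "\<And>k. norm_bound (D ^\<^sub>m k) c"
    using spectral_radius_jnf_norm_bound_less_1_upper_triangular[OF D] by blast
  hence c: "norm ((D ^\<^sub>m k) $$ (i, j)) \<le> c" if "i < n" "j < n" for i j k
    using that D unfolding norm_bound_def by (metis pow_mat_dim_square)
  have Dpow: "(D ^\<^sub>m k) $$ (i, j) = complex_of_real ((A ^\<^sub>m k) $$ (i, j) / q ^ k)"
    if "i < n" "j < n" for i j k
    using that(2)
  proof (induction k arbitrary: j)
    case 0
    thus ?case using that D A by simp
  next
    case (Suc k)
    have "(D ^\<^sub>m Suc k) $$ (i, j) =
        (\<Sum>l<n. complex_of_real ((A ^\<^sub>m k) $$ (i, l) / q ^ k) * complex_of_real (A $$ (l, j) / q))"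
      unfolding index_pow_mat_Suc[OF D that(1) Suc.prems] using Suc A
      by (intro sum.cong) (auto simp: D_def)
    also have "\<dots> = complex_of_real ((A ^\<^sub>m Suc k) $$ (i, j) / q ^ Suc k)"
      unfolding index_pow_mat_Suc[OF A that(1) Suc.prems] by (simp add: sum_divide_distrib mult.commute)
    finally show ?case .
  qed
  have bound: "(A ^\<^sub>m k) $$ (i, j) \<le> c * q ^ k" if "i < n" "j < n" for i j k
  proof -
    have "norm (complex_of_real ((A ^\<^sub>m k) $$ (i, j) / q ^ k)) \<le> c"
      using c[OF that, of k] unfolding Dpow[OF that] .
    hence "\<bar>(A ^\<^sub>m k) $$ (i, j)\<bar> / q ^ k \<le> c" using q0 by (simp only: norm_of_real)
    thus ?thesis using q0 by (simp add: pos_divide_le_eq)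
  qed
  \<comment> \<open>\<open>Z\<close> does not depend on \<open>k\<close>; growth is read off at
    coordinate 0, which exists because \<open>0 < n\<close>.\<close>
  define Z where "Z = c * sum z {..<n} / z 0"
  have "(r / q) ^ k \<le> Z" for k
  proof -
    have "r ^ k * z 0 \<le> (act {..<n} (\<lambda>i k. A $$ (i, k)) ^^ k) z 0"
      by (rule funpow_act_ge) (use nonneg ge q q0 n in auto)
    also have "\<dots> = (\<Sum>j<n. (A ^\<^sub>m k) $$ (0, j) * z j)"
      using funpow_act_mat[OF A n] by (simp add: act_def)
    also have "\<dots> \<le> (\<Sum>j<n. c * q ^ k * z j)"
      using bound[OF n] z by (intro sum_mono mult_right_mono) (auto simp: less_imp_le)
    also have "\<dots> = c * q ^ k * sum z {..<n}" by (simp add: sum_distrib_left)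
    also have "\<dots> = Z * z 0 * q ^ k" using z[OF n] by (simp add: Z_def)
    finally have "r ^ k / q ^ k * z 0 \<le> Z * z 0" using q0 by (simp add: pos_divide_le_eq mult_ac)
    hence "r ^ k / q ^ k \<le> Z" using z[OF n] by (rule mult_right_le_imp_le)
    thus ?thesis by (simp add: power_divide)
  qed
  moreover have "1 < r / q" using q q0 by simp
  ultimately show False using real_arch_pow[of "r / q" Z] by (meson not_le)
qed

text \<open>Some eigenvalue has modulus equal to the spectral radius, and no positive vector grows
  faster, so the argument for extremal eigenvectors applies.\<close>

lemma primitive_mat_perron:
  assumes A: "A \<in> carrier_mat n n" and n: "0 < n" and prim: "primitive_mat A"
  shows "0 < spec_rad A"
    and "\<exists>v. (\<forall>i<n. 0 < v i) \<and> (\<forall>i<n. act {..<n} (\<lambda>i k. A $$ (i, k)) v i = spec_rad A * v i)"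
proof -
  obtain m where B: "eventually_positive {..<n} (\<lambda>i k. A $$ (i, k)) m (\<lambda>i k. (A ^\<^sub>m m) $$ (i, k))"
    by (rule primitive_mat_eventually_positive[OF A prim])
  obtain \<mu> where \<mu>: "eigenvalue (map_mat complex_of_real A) \<mu>" "norm \<mu> = spec_rad A"
    by (rule spectral_radius_eigenvalue[OF _ n, of "map_mat complex_of_real A"]) (use A in auto)
  obtain x where x: "\<And>i. i < n \<Longrightarrow> (\<Sum>k<n. complex_of_real (A $$ (i, k)) * x k) = \<mu> * x i"
    and nz: "\<exists>i<n. x i \<noteq> 0"
    using eigenvalue_sum[OF A \<mu>(1)] by blast
  have growth: False if "spec_rad A < r" "\<And>i. i \<in> {..<n} \<Longrightarrow> 0 < z i"
    "\<And>i. i \<in> {..<n} \<Longrightarrow> r * z i \<le> act {..<n} (\<lambda>i k. A $$ (i, k)) z i" for r z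
    using superinvariant_growth_le_spec_rad[OF A n, of z r] that B
    by (auto simp: eventually_positive_def)
  note * = perron_of_extremal_eigenvector[OF B _ _ \<mu>(2) growth, of x]
  show "0 < spec_rad A" by (rule *(1)) (use x nz in auto)
  have "\<exists>v. (\<forall>i\<in>{..<n}. 0 < v i) \<and>
      (\<forall>i\<in>{..<n}. act {..<n} (\<lambda>i k. A $$ (i, k)) v i = spec_rad A * v i)"
    by (rule *(2)) (use x nz in auto)
  thus "\<exists>v. (\<forall>i<n. 0 < v i) \<and> (\<forall>i<n. act {..<n} (\<lambda>i k. A $$ (i, k)) v i = spec_rad A * v i)"
    by auto
qed

text \<open>The strict bound holds for every eigenvalue, in particular for one of maximal
  modulus.\<close>

lemma primitive_mat_spec_rad_less:
  assumes A: "A \<in> carrier_mat n n" and prim: "primitive_mat A"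
    and v: "\<And>i. i < n \<Longrightarrow> 0 < v i"
    and le: "\<And>i. i < n \<Longrightarrow> act {..<n} (\<lambda>i k. A $$ (i, k)) v i \<le> r * v i"
    and strict: "l < n" "act {..<n} (\<lambda>i k. A $$ (i, k)) v l < r * v l"
  shows "spec_rad A < r"
proof -
  obtain m where B: "eventually_positive {..<n} (\<lambda>i k. A $$ (i, k)) m (\<lambda>i k. (A ^\<^sub>m m) $$ (i, k))"
    by (rule primitive_mat_eventually_positive[OF A prim])
  obtain \<mu> where \<mu>: "eigenvalue (map_mat complex_of_real A) \<mu>" "norm \<mu> = spec_rad A"
    by (rule spectral_radius_eigenvalue[of "map_mat complex_of_real A" n]) (use A strict(1) in auto)
  obtain x where x: "\<And>i. i < n \<Longrightarrow> (\<Sum>k<n. complex_of_real (A $$ (i, k)) * x k) = \<mu> * x i"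
    and nz: "\<exists>i<n. x i \<noteq> 0"
    using eigenvalue_sum[OF A \<mu>(1)] by blast
  have "norm \<mu> < r"
    by (rule eigenvalue_less_of_strictly_subinvariant[OF B, of x \<mu> v r l])
      (use x nz v le strict in auto)
  thus ?thesis by (simp add: \<mu>(2))
qed

subsection \<open>Principal submatrices\<close>

lemma principal_submatrix_carrier:
  assumes "X \<in> carrier_mat K K" "S \<subseteq> {..<K}"
  shows "principal_submatrix X S \<in> carrier_mat (card S) (card S)"
proof -
  have "{i. i < K \<and> i \<in> S} = S" using assms(2) by auto
  thus ?thesis using assms(1) by (intro carrier_matI) (simp_all add: dim_submatrix)
qed

lemma principal_submatrix_index:
  assumes "X \<in> carrier_mat K K" "S \<subseteq> {..<K}" "a < card S" "b < card S"
  shows "principal_submatrix X S $$ (a, b) = X $$ (pick S a, pick S b)"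
proof -
  have "{i. i < K \<and> i \<in> S} = S" using assms(2) by auto
  thus ?thesis using assms by (intro submatrix_index) auto
qed

lemma bij_betw_pick:
  assumes "finite S"
  shows "bij_betw (pick S) {..<card S} S"
proof -
  have inj: "inj_on (pick S) {..<card S}"
    by (rule inj_on_inverseI[where g = "\<lambda>i. card {a \<in> S. a < i}"]) (simp add: card_pick_le)
  have "pick S ` {..<card S} = S"
    using assms inj by (intro card_subset_eq) (auto simp: card_image pick_in_set_le)
  with inj show ?thesis by (simp add: bij_betw_def)
qed

text \<open>The inverse of \<open>pick S\<close>: the position of an index of \<open>S\<close>
  inside the principal submatrix.\<close>

definition rank_in :: "nat set \<Rightarrow> nat \<Rightarrow> nat" where
  "rank_in S i = card {a \<in> S. a < i}"

lemma pick_rank_in [simp]: "i \<in> S \<Longrightarrow> pick S (rank_in S i) = i"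
  unfolding rank_in_def by (rule pick_card_in_set)

lemma rank_in_pick [simp]: "a < card S \<Longrightarrow> rank_in S (pick S a) = a"
  unfolding rank_in_def by (rule card_pick_le)

lemma rank_in_less: "finite S \<Longrightarrow> i \<in> S \<Longrightarrow> rank_in S i < card S"
  unfolding rank_in_def by (intro psubset_card_mono) auto

abbreviation entries :: "real mat \<Rightarrow> nat \<Rightarrow> nat \<Rightarrow> real" where
  "entries X \<equiv> \<lambda>i k. X $$ (i, k)"

text \<open>\<open>pick S\<close> translates positions in the submatrix into original indices, which
  carries the results on matrices over to operators on \<open>S\<close>.\<close>

lemma act_principal_submatrix:
  assumes "X \<in> carrier_mat K K" "S \<subseteq> {..<K}" "a < card S"
  shows "act {..<card S} (entries (principal_submatrix X S)) (\<lambda>b. w (pick S b)) a =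
    act S (entries X) w (pick S a)"
proof -
  have "bij_betw (pick S) {..<card S} S"
    using assms(2) by (intro bij_betw_pick) (rule finite_subset, auto)
  thus ?thesis unfolding act_def
    by (subst sum.reindex_bij_betw[symmetric]) (auto simp: principal_submatrix_index[OF assms(1,2)] assms(3) intro!: sum.cong)
qed

lemma funpow_act_principal_submatrix:
  assumes "X \<in> carrier_mat K K" "S \<subseteq> {..<K}" "a < card S"
  shows "(act {..<card S} (entries (principal_submatrix X S)) ^^ m) (\<lambda>b. w (pick S b)) a =
    (act S (entries X) ^^ m) w (pick S a)"
  using assms(3)
proof (induction m arbitrary: a)
  case (Suc m)
  have "(act {..<card S} (entries (principal_submatrix X S)) ^^ Suc m) (\<lambda>b. w (pick S b)) a =
      act {..<card S} (entries (principal_submatrix X S)) (\<lambda>b. (act S (entries X) ^^ m) w (pick S b)) a"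
    using Suc by (auto intro!: act_cong)
  thus ?case using act_principal_submatrix[OF assms(1,2) Suc.prems] by simp
qed simp

lemma primitive_submatrix_eventually_positive:
  assumes X: "X \<in> carrier_mat K K" and S: "S \<subseteq> {..<K}"
    and prim: "primitive_mat (principal_submatrix X S)"
  obtains m B where "eventually_positive S (entries X) m B"
proof -
  let ?A = "principal_submatrix X S"
  have fin: "finite S" using S finite_subset by blast
  have A: "?A \<in> carrier_mat (card S) (card S)" by (rule principal_submatrix_carrier[OF X S])
  obtain m where m: "eventually_positive {..<card S} (entries ?A) m (entries (?A ^\<^sub>m m))"
    by (rule primitive_mat_eventually_positive[OF A prim])
  \<comment> \<open>\<open>B\<close> is a power of the submatrix with its positions relabelled, not
    a submatrix of a power of \<open>X\<close>; walks leaving \<open>S\<close> are not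
    counted.\<close>
  define B where "B i k = (?A ^\<^sub>m m) $$ (rank_in S i, rank_in S k)" for i k
  have nonneg: "0 \<le> X $$ (i, k)" if "i \<in> S" "k \<in> S" for i k
  proof -
    have "0 \<le> ?A $$ (rank_in S i, rank_in S k)"
      using m rank_in_less[OF fin] that unfolding eventually_positive_def by simp
    thus ?thesis
      using principal_submatrix_index[OF X S, of "rank_in S i" "rank_in S k"] rank_in_less[OF fin] that
      by simp
  qed
  have pow: "(act S (entries X) ^^ m) w i = act S B w i" if i: "i \<in> S" for w i
  proof -
    have "(act S (entries X) ^^ m) w i =
        (act {..<card S} (entries ?A) ^^ m) (\<lambda>b. w (pick S b)) (rank_in S i)"
      using funpow_act_principal_submatrix[OF X S rank_in_less[OF fin i]] i by simp
    also have "\<dots> = (\<Sum>b<card S. (?A ^\<^sub>m m) $$ (rank_in S i, b) * w (pick S b))"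
      using funpow_act_mat[OF A rank_in_less[OF fin i]] by (simp add: act_def)
    also have "\<dots> = (\<Sum>b<card S. B i (pick S b) * w (pick S b))"
      by (intro sum.cong) (auto simp: B_def)
    also have "\<dots> = act S B w i"
      unfolding act_def by (rule sum.reindex_bij_betw[OF bij_betw_pick[OF fin]])
    finally show ?thesis .
  qed
  have "eventually_positive S (entries X) m B"
    using m nonneg pow fin rank_in_less[OF fin] unfolding eventually_positive_def B_def by auto
  thus ?thesis by (rule that)
qed

lemma primitive_submatrix_perron:
  assumes X: "X \<in> carrier_mat K K" and S: "S \<subseteq> {..<K}" and ne: "S \<noteq> {}"
    and prim: "primitive_mat (principal_submatrix X S)"
  shows "0 < spec_rad (principal_submatrix X S)"
    and "\<exists>v. (\<forall>i\<in>S. 0 < v i) \<and>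
      (\<forall>i\<in>S. act S (entries X) v i = spec_rad (principal_submatrix X S) * v i)"
proof -
  let ?A = "principal_submatrix X S"
  have fin: "finite S" using S finite_subset by blast
  have A: "?A \<in> carrier_mat (card S) (card S)" by (rule principal_submatrix_carrier[OF X S])
  have n: "0 < card S" using fin ne by auto
  show "0 < spec_rad ?A" by (rule primitive_mat_perron(1)[OF A n prim])
  obtain v where v: "\<And>a. a < card S \<Longrightarrow> 0 < v a"
    "\<And>a. a < card S \<Longrightarrow> act {..<card S} (entries ?A) v a = spec_rad ?A * v a"
    using primitive_mat_perron(2)[OF A n prim] by blast
  have "act S (entries X) (\<lambda>i. v (rank_in S i)) i = spec_rad ?A * v (rank_in S i)"
    if i: "i \<in> S" for i
  proof -
    have "act S (entries X) (\<lambda>i. v (rank_in S i)) i =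
        act {..<card S} (entries ?A) (\<lambda>b. v (rank_in S (pick S b))) (rank_in S i)"
      using act_principal_submatrix[OF X S rank_in_less[OF fin i], of "\<lambda>k. v (rank_in S k)"] i
      by simp
    also have "\<dots> = act {..<card S} (entries ?A) v (rank_in S i)"
      by (rule act_cong) simp
    finally show ?thesis using v rank_in_less[OF fin i] by simp
  qed
  thus "\<exists>v. (\<forall>i\<in>S. 0 < v i) \<and> (\<forall>i\<in>S. act S (entries X) v i = spec_rad ?A * v i)"
    using v(1) rank_in_less[OF fin] by (intro exI[of _ "\<lambda>i. v (rank_in S i)"]) auto
qed

lemma primitive_submatrix_spec_rad_less:
  assumes X: "X \<in> carrier_mat K K" and S: "S \<subseteq> {..<K}"
    and prim: "primitive_mat (principal_submatrix X S)"
    and v: "\<And>i. i \<in> S \<Longrightarrow> 0 < v i"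
    and le: "\<And>i. i \<in> S \<Longrightarrow> act S (entries X) v i \<le> r * v i"
    and strict: "l \<in> S" "act S (entries X) v l < r * v l"
  shows "spec_rad (principal_submatrix X S) < r"
proof -
  have fin: "finite S" using S finite_subset by blast
  show ?thesis
    by (rule primitive_mat_spec_rad_less[OF principal_submatrix_carrier[OF X S] prim,
          of "\<lambda>a. v (pick S a)" r "rank_in S l"])
      (use v le strict pick_in_set_le rank_in_less[OF fin] in
        \<open>auto simp: act_principal_submatrix[OF X S]\<close>)
qed

section \<open>Reachability and principal submatrices\<close>

lemma pow_mat_nonneg:
  assumes "X \<in> carrier_mat K K" "\<And>i k. i < K \<Longrightarrow> k < K \<Longrightarrow> 0 \<le> X $$ (i, k)" "i < K" "k < K"
  shows "(0::real) \<le> (X ^\<^sub>m n) $$ (i, k)"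
  using assms(4)
proof (induction n arbitrary: k)
  case 0
  thus ?case using assms by simp
next
  case (Suc n)
  show ?case unfolding index_pow_mat_Suc[OF assms(1,3) Suc.prems]
    using Suc assms(2) by (auto intro!: sum_nonneg)
qed

text \<open>Powers of the submatrix sum over walks that stay in \<open>S\<close>; the walks left out
  contribute nonnegative weights to the power of \<open>X\<close>.\<close>

lemma pow_principal_submatrix_le:
  assumes X: "X \<in> carrier_mat K K" "\<And>i k. i < K \<Longrightarrow> k < K \<Longrightarrow> 0 \<le> X $$ (i, k)"
    and S: "S \<subseteq> {..<K}" and a: "a < card S" and b: "b < card S"
  shows "(principal_submatrix X S ^\<^sub>m n) $$ (a, b) \<le> (X ^\<^sub>m n) $$ (pick S a, pick S b)"
  using b
proof (induction n arbitrary: b)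
  let ?A = "principal_submatrix X S"
  have fin: "finite S" using S finite_subset by blast
  have A: "?A \<in> carrier_mat (card S) (card S)" by (rule principal_submatrix_carrier[OF X(1) S])
  have pick: "pick S c < K" if "c < card S" for c using pick_in_set_le[OF that] S by auto
  {
    case 0
    have "(?A ^\<^sub>m 0) $$ (a, b) = (if a = b then 1 else 0)" using A a 0 by simp
    also have "\<dots> \<le> (X ^\<^sub>m 0) $$ (pick S a, pick S b)" using X(1) pick[OF a] pick[OF 0] by auto
    finally show ?case .
  next
    case (Suc n)
    have "(?A ^\<^sub>m Suc n) $$ (a, b) = (\<Sum>l<card S. (?A ^\<^sub>m n) $$ (a, l) * X $$ (pick S l, pick S b))"
      unfolding index_pow_mat_Suc[OF A a Suc.prems]
      using Suc.prems by (intro sum.cong) (auto simp: principal_submatrix_index[OF X(1) S])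
    also have "\<dots> \<le> (\<Sum>l<card S. (X ^\<^sub>m n) $$ (pick S a, pick S l) * X $$ (pick S l, pick S b))"
      using Suc pick X(2) by (intro sum_mono mult_right_mono) auto
    also have "\<dots> = (\<Sum>l\<in>S. (X ^\<^sub>m n) $$ (pick S a, l) * X $$ (l, pick S b))"
      by (rule sum.reindex_bij_betw[OF bij_betw_pick[OF fin]])
    also have "\<dots> \<le> (\<Sum>l<K. (X ^\<^sub>m n) $$ (pick S a, l) * X $$ (l, pick S b))"
      using S pick a Suc.prems X(2) pow_mat_nonneg[OF X]
      by (intro sum_mono2) (auto intro!: mult_nonneg_nonneg)
    also have "\<dots> = (X ^\<^sub>m Suc n) $$ (pick S a, pick S b)"
      using index_pow_mat_Suc[OF X(1) pick[OF a] pick[OF Suc.prems]] by simp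
    finally show ?case .
  }
qed

lemma primitive_submatrix_reachable:
  assumes X: "X \<in> carrier_mat K K" "\<And>i k. i < K \<Longrightarrow> k < K \<Longrightarrow> 0 \<le> X $$ (i, k)"
    and S: "S \<subseteq> {..<K}" and prim: "primitive_mat (principal_submatrix X S)"
    and i: "i \<in> S" and k: "k \<in> S"
  shows "k \<in> reachable_from X i"
proof -
  have fin: "finite S" using S finite_subset by blast
  note rank = rank_in_less[OF fin i] rank_in_less[OF fin k]
  obtain n where "0 < (principal_submatrix X S ^\<^sub>m n) $$ (rank_in S i, rank_in S k)"
    using prim rank principal_submatrix_carrier[OF X(1) S] unfolding primitive_mat_def
    by (metis carrier_matD(1))
  also have "\<dots> \<le> (X ^\<^sub>m n) $$ (i, k)"
    using pow_principal_submatrix_le[OF X S rank, of n] i k by simp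
  finally show ?thesis using X(1) S i k unfolding reachable_from_def by auto
qed

lemma reachable_from_step:
  assumes X: "X \<in> carrier_mat K K" "\<And>i k. i < K \<Longrightarrow> k < K \<Longrightarrow> 0 \<le> X $$ (i, k)"
    and "k \<in> reachable_from X i" "0 < X $$ (k, l)" "l < K"
  shows "l \<in> reachable_from X i"
proof -
  obtain n where n: "i < K" "k < K" "0 < (X ^\<^sub>m n) $$ (i, k)"
    using assms(1,3) unfolding reachable_from_def by auto
  have "0 < (X ^\<^sub>m n) $$ (i, k) * X $$ (k, l)" using n assms(4) by simp
  also have "\<dots> \<le> (\<Sum>m<K. (X ^\<^sub>m n) $$ (i, m) * X $$ (m, l))"
    using n assms(5) X(2) pow_mat_nonneg[OF X]
    by (intro member_le_sum[where f = "\<lambda>m. (X ^\<^sub>m n) $$ (i, m) * X $$ (m, l)"])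
      (auto intro!: mult_nonneg_nonneg)
  also have "\<dots> = (X ^\<^sub>m Suc n) $$ (i, l)" using index_pow_mat_Suc[OF X(1) n(1) assms(5)] by simp
  finally show ?thesis using X(1) n(1) assms(5) unfolding reachable_from_def by blast
qed

lemma reachable_from_subset_closed:
  assumes X: "X \<in> carrier_mat K K" "\<And>i k. i < K \<Longrightarrow> k < K \<Longrightarrow> 0 \<le> X $$ (i, k)"
    and closed: "\<And>i k. i \<in> S \<Longrightarrow> k < K \<Longrightarrow> 0 < X $$ (i, k) \<Longrightarrow> k \<in> S" and i: "i \<in> S"
  shows "reachable_from X i \<subseteq> S"
proof
  fix k assume "k \<in> reachable_from X i"
  then obtain n where n: "i < K" "k < K" "0 < (X ^\<^sub>m n) $$ (i, k)"
    using X(1) unfolding reachable_from_def by auto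
  from n(2,3) show "k \<in> S"
  proof (induction n arbitrary: k)
    case 0
    thus ?case using X(1) n(1) i by (auto split: if_splits)
  next
    case (Suc n)
    have "0 < (\<Sum>l<K. (X ^\<^sub>m n) $$ (i, l) * X $$ (l, k))"
      using Suc.prems(2) unfolding index_pow_mat_Suc[OF X(1) n(1) Suc.prems(1)] .
    \<comment> \<open>A positive sum has a positive term, whose intermediate index \<open>l\<close>
      is reached in one step fewer.\<close>
    then obtain l where l: "l < K" "0 < (X ^\<^sub>m n) $$ (i, l) * X $$ (l, k)"
      by (metis (no_types, lifting) lessThan_iff not_le sum_nonpos)
    hence "0 < (X ^\<^sub>m n) $$ (i, l)" "0 < X $$ (l, k)"
      using pow_mat_nonneg[OF X n(1) l(1), of n] X(2)[OF l(1) Suc.prems(1)]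
      by (auto simp: zero_less_mult_iff)
    thus ?case using Suc.IH closed l(1) Suc.prems(1) by blast
  qed
qed

section \<open>Path matrices\<close>

lemma fin_digraph_underlying:
  assumes "fin_digraph G"
  shows "fin_digraph (underlying G)"
proof -
  interpret fin_digraph G by fact
  show ?thesis by unfold_locales (auto simp: underlying_def)
qed

lemma path_matrices_carrier:
  "D \<in> path_matrices E \<Longrightarrow> D \<in> carrier_mat (ncolours E) (ncolours E)"
  by (auto simp: path_matrices_def path_matrix_def)

lemma path_matrices_nonneg:
  "D \<in> path_matrices E \<Longrightarrow> i < ncolours E \<Longrightarrow> k < ncolours E \<Longrightarrow> 0 \<le> D $$ (i, k)"
  by (auto simp: path_matrices_def path_matrix_def)

text \<open>A finite graph has finitely many simple paths, and only the paths at the finitely many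
  colours matter.\<close>

lemma (in eigs) finite_path_matrices: "finite (path_matrices E)"
proof -
  define P where
    "P i = {p. simple_path (rule_graph E i) (planting_plus E i) p (planting_minus E i)}" for i
  have "finite (P i)" if "i < ncolours E" for i
    using fin_digraph.apaths_finite[OF fin_digraph_underlying[OF finite_rule[OF that]]]
    by (simp add: P_def)
  hence "finite (path_matrix E ` PiE {..<ncolours E} P)" by (intro finite_imageI finite_PiE) auto
  moreover have "path_matrices E \<subseteq> path_matrix E ` PiE {..<ncolours E} P"
  proof
    fix D assume "D \<in> path_matrices E"
    then obtain p where p: "D = path_matrix E p" "\<forall>i<ncolours E. p i \<in> P i"
      unfolding path_matrices_def P_def by auto
    \<comment> \<open>Values of \<open>p\<close> off the colours are discarded to land in the
      extensional product.\<close>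
    have "D = path_matrix E (restrict p {..<ncolours E})"
      unfolding p(1) path_matrix_def by (rule eq_matI) auto
    thus "D \<in> path_matrix E ` PiE {..<ncolours E} P" using p(2) by auto
  qed
  ultimately show ?thesis by (rule finite_subset[rotated])
qed

text \<open>Row \<open>i\<close> depends only on the path chosen at colour \<open>i\<close>, so the
  diagonal choice \<open>p i i\<close> of the witnesses works.\<close>

lemma path_matrices_combine_rows:
  assumes "\<And>i. i < ncolours E \<Longrightarrow> F i \<in> path_matrices E"
  obtains D where "D \<in> path_matrices E"
    and "\<And>i k. i < ncolours E \<Longrightarrow> k < ncolours E \<Longrightarrow> D $$ (i, k) = F i $$ (i, k)"
proof -
  have "\<exists>p. F i = path_matrix E p \<and>
      (\<forall>l<ncolours E. simple_path (rule_graph E l) (planting_plus E l) (p l) (planting_minus E l))"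
    if "i < ncolours E" for i
    using assms[OF that] unfolding path_matrices_def by blast
  then obtain p where p: "\<And>i. i < ncolours E \<Longrightarrow> F i = path_matrix E (p i)"
    "\<And>i l. i < ncolours E \<Longrightarrow> l < ncolours E \<Longrightarrow>
      simple_path (rule_graph E l) (planting_plus E l) (p i l) (planting_minus E l)"
    by metis
  show ?thesis
  proof (rule that)
    show "path_matrix E (\<lambda>i. p i i) \<in> path_matrices E"
      using p(2) unfolding path_matrices_def by blast
  qed (simp add: p(1) path_matrix_def)
qed

text \<open>Keeps the exchanged matrix among the competitors in the minimum defining
  \<open>distance_rate\<close>; it is a combination of rows of \<open>X\<close> and
  \<open>Y\<close>.\<close>

lemma replace_row_path_matrices:
  assumes "X \<in> path_matrices E" "Y \<in> path_matrices E"
  shows "replace_row X i Y \<in> path_matrices E"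
proof -
  obtain D where D: "D \<in> path_matrices E"
    "\<And>r k. r < ncolours E \<Longrightarrow> k < ncolours E \<Longrightarrow> D $$ (r, k) = (if r = i then Y else X) $$ (r, k)"
    by (rule path_matrices_combine_rows[of E "\<lambda>r. if r = i then Y else X"]) (use assms in auto)
  have "replace_row X i Y = D"
    using D path_matrices_carrier[OF assms(1)] path_matrices_carrier[OF D(1)]
    by (intro eq_matI) (auto simp: replace_row_def)
  thus ?thesis using D(1) by simp
qed

section \<open>Norms of products of path matrices\<close>

lemma mat_prod_list_carrier:
  "set Ds \<subseteq> carrier_mat K K \<Longrightarrow> mat_prod_list K Ds \<in> carrier_mat K K"
  by (induction Ds) (auto simp: mat_prod_list_def)

lemma mat_prod_list_nonneg:
  assumes "set Ds \<subseteq> path_matrices E" "i < ncolours E" "k < ncolours E"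
  shows "0 \<le> mat_prod_list (ncolours E) Ds $$ (i, k)"
  using assms
proof (induction Ds arbitrary: i)
  case Nil
  thus ?case by (simp add: mat_prod_list_def)
next
  case (Cons D Ds)
  let ?P = "mat_prod_list (ncolours E) Ds"
  have "?P \<in> carrier_mat (ncolours E) (ncolours E)"
    using Cons.prems path_matrices_carrier by (intro mat_prod_list_carrier) auto
  hence "(D * ?P) $$ (i, k) = (\<Sum>l<ncolours E. D $$ (i, l) * ?P $$ (l, k))"
    using Cons.prems path_matrices_carrier by (intro index_mult_mat_sum) auto
  also have "0 \<le> \<dots>"
    using Cons path_matrices_nonneg by (intro sum_nonneg mult_nonneg_nonneg) auto
  finally show ?case by (simp add: mat_prod_list_def)
qed

text \<open>Multiplication by a unit vector selects row \<open>i\<close>, and the absolute values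
  disappear because all entries are nonnegative.\<close>

lemma product_norm_row_sum:
  assumes "set Ds \<subseteq> path_matrices E" "i < ncolours E"
  shows "product_norm E i Ds = (\<Sum>k<ncolours E. mat_prod_list (ncolours E) Ds $$ (i, k))"
proof -
  let ?P = "mat_prod_list (ncolours E) Ds"
  have P: "?P \<in> carrier_mat (ncolours E) (ncolours E)"
    using assms path_matrices_carrier by (intro mat_prod_list_carrier) auto
  have "(transpose_mat ?P *\<^sub>v unit_vec (ncolours E) i) $ k = ?P $$ (i, k)" if "k < ncolours E" for k
    using P assms(2) that by simp
  thus ?thesis using P mat_prod_list_nonneg[OF assms]
    by (auto simp: product_norm_def l1_norm_def row_vec_mult_def intro!: sum.cong)
qed

lemma product_norm_Nil: "i < ncolours E \<Longrightarrow> product_norm E i [] = 1"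
  by (subst product_norm_row_sum) (auto simp: mat_prod_list_def)

text \<open>Splitting off the leftmost factor gives a recursion in which \<open>D\<close> acts on
  the vector of norms of the remaining product, one entry per starting colour.\<close>

lemma product_norm_Cons:
  assumes "set (D # Ds) \<subseteq> path_matrices E" "i < ncolours E"
  shows "product_norm E i (D # Ds) = (\<Sum>l<ncolours E. D $$ (i, l) * product_norm E l Ds)"
proof -
  let ?P = "mat_prod_list (ncolours E) Ds"
  have P: "?P \<in> carrier_mat (ncolours E) (ncolours E)"
    using assms path_matrices_carrier by (intro mat_prod_list_carrier) auto
  have D: "D \<in> carrier_mat (ncolours E) (ncolours E)" using assms path_matrices_carrier by auto
  have "product_norm E i (D # Ds) = (\<Sum>k<ncolours E. (D * ?P) $$ (i, k))"
    using product_norm_row_sum[OF assms] by (simp add: mat_prod_list_def)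
  also have "\<dots> = (\<Sum>k<ncolours E. \<Sum>l<ncolours E. D $$ (i, l) * ?P $$ (l, k))"
    using index_mult_mat_sum[OF D P assms(2)] by (intro sum.cong) auto
  also have "\<dots> = (\<Sum>l<ncolours E. D $$ (i, l) * product_norm E l Ds)"
    using assms(1) by (subst sum.swap) (auto simp: product_norm_row_sum sum_distrib_left intro!: sum.cong)
  finally show ?thesis .
qed

section \<open>The optimal path matrix at a colour\<close>

text \<open>Fixes the matrix \<open>X\<close> that local primitive stability provides at the single
  colour \<open>j\<close>.\<close>

locale stable_colour = eigs E for E :: "('v, 'e) edge_system" +
  fixes j :: nat and X :: "real mat"
  assumes j: "j < ncolours E"
    and X: "X \<in> path_matrices E"
    and opt: "spec_rad (principal_submatrix X (support_set E j)) = distance_rate E j"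
    and prim: "primitive_mat (principal_submatrix X (support_set E j))"
    and stable: "\<And>i Y. i \<in> support_set E j \<Longrightarrow> Y \<in> path_matrices E \<Longrightarrow>
      primitive_mat (principal_submatrix (replace_row X i Y) (support_set E j))"
begin

abbreviation "K \<equiv> ncolours E"
abbreviation "S \<equiv> support_set E j"
abbreviation "r \<equiv> distance_rate E j"

section \<open>Closedness of the support and superinvariance of the Perron vector\<close>

lemma S_subset: "S \<subseteq> {..<K}"
  using path_matrices_carrier by (fastforce simp: support_set_def reachable_from_def)

lemma j_in_S: "j \<in> S"
proof -
  have "j \<in> reachable_from X j"
    using path_matrices_carrier[OF X] j unfolding reachable_from_def
    by (auto intro!: exI[of _ "0 :: nat"])
  thus ?thesis using X unfolding support_set_def by blast
qed

lemma replace_row_index: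
  "i < K \<Longrightarrow> k < K \<Longrightarrow> replace_row X l Y $$ (i, k) = (if i = l then Y $$ (i, k) else X $$ (i, k))"
  using path_matrices_carrier[OF X] by (simp add: replace_row_def)

text \<open>Substituting row \<open>i\<close> of \<open>D\<close> into \<open>X\<close> keeps \<open>i\<close> reachable from \<open>j\<close>, by primitivity.\<close>

lemma S_closed:
  assumes D: "D \<in> path_matrices E" and i: "i \<in> S" and k: "k < K" "0 < D $$ (i, k)"
  shows "k \<in> S"
proof -
  let ?Y = "replace_row X i D"
  have Y: "?Y \<in> path_matrices E" by (rule replace_row_path_matrices[OF X D])
  note Ymat = path_matrices_carrier[OF Y] path_matrices_nonneg[OF Y]
  have "i < K" using i S_subset by auto
  have "i \<in> reachable_from ?Y j"
    by (rule primitive_submatrix_reachable[OF Ymat S_subset stable[OF i D] j_in_S i])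
  moreover have "0 < ?Y $$ (i, k)" using k \<open>i < K\<close> by (simp add: replace_row_index)
  ultimately have "k \<in> reachable_from ?Y j" using reachable_from_step[OF Ymat] k(1) by blast
  thus ?thesis using Y unfolding support_set_def by blast
qed

text \<open>No path matrix has a positive entry leading out of \<open>S\<close>, so the terms
  outside \<open>S\<close> vanish.\<close>

lemma act_S:
  assumes "D \<in> path_matrices E" "i \<in> S"
  shows "act S (entries D) w i = (\<Sum>k<K. D $$ (i, k) * w k)"
  unfolding act_def
proof (rule sum.mono_neutral_left)
  show "\<forall>k\<in>{..<K} - S. D $$ (i, k) * w k = 0"
    using assms S_closed[OF assms] path_matrices_nonneg[OF assms(1)] S_subset
    by (metis Diff_iff lessThan_iff less_eq_real_def mult_eq_0_iff subsetD)
qed (use S_subset in auto)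

text \<open>Primitivity makes the indices of \<open>S\<close> mutually reachable and
  \<open>S_closed\<close> prevents leaving it, so for \<open>Y\<close> the maximum in
  \<open>distance_rate\<close> runs over a single block.\<close>

lemma reachable_blocks_primitive:
  assumes Y: "Y \<in> path_matrices E" and primY: "primitive_mat (principal_submatrix Y S)"
  shows "reachable_blocks Y j = {S}"
proof -
  note Ymat = path_matrices_carrier[OF Y] path_matrices_nonneg[OF Y]
  have reach: "reachable_from Y i = S" if "i \<in> S" for i
    using primitive_submatrix_reachable[OF Ymat S_subset primY that]
      reachable_from_subset_closed[OF Ymat _ that] S_closed[OF Y] by blast
  have block: "block_of Y i = S" if "i \<in> S" for i
    unfolding block_of_def using that by (auto simp: reach)
  \<comment> \<open>A block meeting \<open>S\<close> has its representative reachable from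
    \<open>S\<close>, hence in \<open>S\<close>.\<close>
  have "B = S" if B: "B \<in> blocks Y" "b \<in> B" "b \<in> S" for B b
  proof -
    obtain i where "B = block_of Y i" using B(1) unfolding blocks_def by blast
    moreover from this have "i \<in> S" using B(2,3) reach by (auto simp: block_of_def)
    ultimately show ?thesis using block by simp
  qed
  moreover have "S \<in> blocks Y"
    unfolding blocks_def using block[OF j_in_S] j Ymat(1) by (auto intro!: image_eqI[of _ _ j])
  ultimately show ?thesis
    unfolding reachable_blocks_def block[OF j_in_S] using reach j_in_S by auto
qed

lemma distance_rate_le:
  assumes Y: "Y \<in> path_matrices E" and primY: "primitive_mat (principal_submatrix Y S)"
  shows "r \<le> spec_rad (principal_submatrix Y S)"
proof -
  have "r \<le> (MAX B \<in> reachable_blocks Y j. spec_rad (principal_submatrix Y B))"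
    unfolding distance_rate_def using Y finite_path_matrices by (intro Min_le) auto
  thus ?thesis by (simp add: reachable_blocks_primitive[OF Y primY])
qed

text \<open>A row of \<open>D\<close> violating the inequality could be substituted into \<open>X\<close> to lower its spectral
  radius below the minimum \<open>r\<close>.\<close>

lemma perron_vector_superinvariant:
  assumes v: "\<And>i. i \<in> S \<Longrightarrow> 0 < v i" and Xv: "\<And>i. i \<in> S \<Longrightarrow> act S (entries X) v i = r * v i"
    and D: "D \<in> path_matrices E" and i: "i \<in> S"
  shows "r * v i \<le> act S (entries D) v i"
proof (rule ccontr)
  assume less: "\<not> r * v i \<le> act S (entries D) v i"
  let ?Y = "replace_row X i D"
  have Y: "?Y \<in> path_matrices E" by (rule replace_row_path_matrices[OF X D])
  have primY: "primitive_mat (principal_submatrix ?Y S)" by (rule stable[OF i D])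
  \<comment> \<open>Only row \<open>i\<close> changes, so \<open>v\<close> keeps its eigenvector
    equation on the other rows and is strictly subinvariant on row \<open>i\<close>.\<close>
  have row: "act S (entries ?Y) v l = (if l = i then act S (entries D) v l else act S (entries X) v l)"
    if "l \<in> S" for l
    using that S_subset by (auto simp: act_def replace_row_index subset_iff intro!: sum.cong)
  have "spec_rad (principal_submatrix ?Y S) < r"
    by (rule primitive_submatrix_spec_rad_less[OF path_matrices_carrier[OF Y] S_subset primY, of v r i])
      (use v i less Xv row in auto)
  thus False using distance_rate_le[OF Y primY] by simp
qed

section \<open>The minimising operator and its iterates\<close>

text \<open>The Bellman operator of the minimisation: each coordinate may use its own path
  matrix.\<close>

definition min_step :: "(nat \<Rightarrow> real) \<Rightarrow> nat \<Rightarrow> real" where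
  "min_step w i = (MIN D \<in> path_matrices E. act S (entries D) w i)"

lemma min_step_le: "D \<in> path_matrices E \<Longrightarrow> min_step w i \<le> act S (entries D) w i"
  unfolding min_step_def using finite_path_matrices by (intro Min_le) auto

lemma min_step_attained:
  obtains D where "D \<in> path_matrices E" "min_step w i = act S (entries D) w i"
proof -
  have "min_step w i \<in> (\<lambda>D. act S (entries D) w i) ` path_matrices E"
    unfolding min_step_def using finite_path_matrices X by (intro Min_in) auto
  thus ?thesis using that by blast
qed

lemma act_path_matrix_mono:
  assumes "D \<in> path_matrices E" "i \<in> S" "\<And>k. k \<in> S \<Longrightarrow> w k \<le> w' k"
  shows "act S (entries D) w i \<le> act S (entries D) w' i"
  using assms path_matrices_nonneg[OF assms(1)] S_subset by (intro act_mono) auto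

lemma min_step_mono:
  assumes "\<And>k. k \<in> S \<Longrightarrow> w k \<le> w' k" "i \<in> S"
  shows "min_step w i \<le> min_step w' i"
proof -
  obtain D where D: "D \<in> path_matrices E" "min_step w' i = act S (entries D) w' i"
    by (rule min_step_attained)
  have "min_step w i \<le> act S (entries D) w i" by (rule min_step_le[OF D(1)])
  also have "\<dots> \<le> act S (entries D) w' i" by (rule act_path_matrix_mono[OF D(1) assms(2,1)])
  finally show ?thesis using D(2) by simp
qed

text \<open>Dynamic programming: the first factor gives at least the minimum over all path matrices,
  and monotonicity carries along the bound for the shorter product.\<close>

lemma min_step_iterate_le_product_norm:
  assumes "set Ds \<subseteq> path_matrices E" "i \<in> S"
  shows "(min_step ^^ length Ds) (\<lambda>_. 1) i \<le> product_norm E i Ds"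
  using assms
proof (induction Ds arbitrary: i)
  case Nil
  thus ?case using S_subset by (auto simp: product_norm_Nil)
next
  case (Cons D Ds)
  have D: "D \<in> path_matrices E" using Cons.prems by simp
  have "min_step ((min_step ^^ length Ds) (\<lambda>_. 1)) i \<le> act S (entries D) ((min_step ^^ length Ds) (\<lambda>_. 1)) i"
    by (rule min_step_le[OF D])
  also have "\<dots> \<le> act S (entries D) (\<lambda>l. product_norm E l Ds) i"
    using Cons by (intro act_path_matrix_mono) auto
  also have "\<dots> = product_norm E i (D # Ds)"
    using product_norm_Cons[OF Cons.prems(1)] act_S[OF D] Cons.prems(2) S_subset by auto
  finally show ?case by simp
qed

text \<open>Since the rows of a path matrix can be chosen independently, one product is optimal for all
  starting colours at once.\<close>

lemma min_step_iterate_attained: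
  "\<exists>Ds. set Ds \<subseteq> path_matrices E \<and> length Ds = n \<and>
    (\<forall>i\<in>S. product_norm E i Ds = (min_step ^^ n) (\<lambda>_. 1) i)"
proof (induction n)
  case 0
  show ?case using S_subset by (intro exI[of _ "[]"]) (auto simp: product_norm_Nil)
next
  case (Suc n)
  then obtain Ds where Ds: "set Ds \<subseteq> path_matrices E" "length Ds = n"
    "\<And>i. i \<in> S \<Longrightarrow> product_norm E i Ds = (min_step ^^ n) (\<lambda>_. 1) i" by blast
  let ?w = "(min_step ^^ n) (\<lambda>_. 1)"
  \<comment> \<open>A minimiser is chosen for each row separately; the rows are then assembled into
    one path matrix \<open>D\<close>.\<close>
  have "\<exists>F. \<forall>i. F i \<in> path_matrices E \<and> min_step ?w i = act S (entries (F i)) ?w i"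
  proof (intro choice allI)
    show "\<exists>D. D \<in> path_matrices E \<and> min_step ?w i = act S (entries D) ?w i" for i
      by (rule min_step_attained[of ?w i]) blast
  qed
  then obtain F where F: "\<And>i. F i \<in> path_matrices E"
    "\<And>i. min_step ?w i = act S (entries (F i)) ?w i" by blast
  obtain D where D: "D \<in> path_matrices E"
    "\<And>i k. i < K \<Longrightarrow> k < K \<Longrightarrow> D $$ (i, k) = F i $$ (i, k)"
    using path_matrices_combine_rows[of E F] F(1) by blast
  have "product_norm E i (D # Ds) = (min_step ^^ Suc n) (\<lambda>_. 1) i" if i: "i \<in> S" for i
  proof -
    have "product_norm E i (D # Ds) = act S (entries D) (\<lambda>l. product_norm E l Ds) i"
      using product_norm_Cons[of D Ds E i] act_S[OF D(1) i] i S_subset D(1) Ds(1) by auto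
    also have "\<dots> = act S (entries (F i)) ?w i"
      unfolding act_def using D(2) Ds(3) i S_subset by (intro sum.cong) auto
    finally show ?thesis using F(2) by simp
  qed
  thus ?case using D(1) Ds(1,2) by (intro exI[of _ "D # Ds"]) auto
qed

text \<open>The iterate is a lower bound for all products of length \<open>n\<close>, and some
  product attains it.\<close>

lemma Min_product_norm:
  "(MIN Ds \<in> {Ds. set Ds \<subseteq> path_matrices E \<and> length Ds = n}. product_norm E j Ds) =
    (min_step ^^ n) (\<lambda>_. 1) j"
proof (rule Min_eqI)
  show "finite (product_norm E j ` {Ds. set Ds \<subseteq> path_matrices E \<and> length Ds = n})"
    using finite_path_matrices by (intro finite_imageI finite_lists_length_eq)
  show "(min_step ^^ n) (\<lambda>_. 1) j \<in> product_norm E j ` {Ds. set Ds \<subseteq> path_matrices E \<and> length Ds = n}"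
    using min_step_iterate_attained[of n] j_in_S by force
qed (use min_step_iterate_le_product_norm j_in_S in auto)

lemma minimal_products:
  shows "\<exists>c>0. (\<lambda>n. 1 / r ^ n *
      (MIN Ds \<in> {Ds. set Ds \<subseteq> path_matrices E \<and> length Ds = n}. product_norm E j Ds)) \<longlonglongrightarrow> c"
    and "\<exists>c>0. \<forall>n. \<forall>Ds. set Ds \<subseteq> path_matrices E \<and> length Ds = n \<longrightarrow>
      product_norm E j Ds \<ge> c * r ^ n"
proof -
  have ne: "S \<noteq> {}" using j_in_S by auto
  note perron = primitive_submatrix_perron[OF path_matrices_carrier[OF X] S_subset ne prim, unfolded opt]
  have r: "0 < r" by (rule perron(1))
  obtain v where v: "\<And>i. i \<in> S \<Longrightarrow> 0 < v i"
    and Xv: "\<And>i. i \<in> S \<Longrightarrow> act S (entries X) v i = r * v i"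
    using perron(2) by blast
  obtain m B where B: "eventually_positive S (entries X) m B"
    by (rule primitive_submatrix_eventually_positive[OF path_matrices_carrier[OF X] S_subset prim])
  \<comment> \<open>The eigenvector of \<open>X\<close> is also one of the nonlinear operator:
    \<open>X\<close> gives the upper bound, superinvariance under every path matrix the
    lower.\<close>
  have min_step_v: "min_step (\<lambda>k. a * v k) i = a * r * v i" if a: "0 \<le> a" and i: "i \<in> S" for a i
  proof (rule antisym)
    show "min_step (\<lambda>k. a * v k) i \<le> a * r * v i"
      using min_step_le[OF X, of "\<lambda>k. a * v k" i] by (simp add: act_scale Xv[OF i])
    obtain D where D: "D \<in> path_matrices E" "min_step (\<lambda>k. a * v k) i = act S (entries D) (\<lambda>k. a * v k) i"
      by (rule min_step_attained)
    have "r * v i \<le> act S (entries D) v i"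
      by (rule perron_vector_superinvariant[OF v Xv D(1) i])
    thus "a * r * v i \<le> min_step (\<lambda>k. a * v k) i"
      using mult_left_mono[OF _ a] by (simp add: D(2) act_scale mult.assoc)
  qed
  note iterates = normalised_iterates_tendsto[OF B ne min_step_mono min_step_v min_step_le[OF X] v Xv r]
  obtain c where c: "c > 0" "\<And>i. i \<in> S \<Longrightarrow> (\<lambda>n. (min_step ^^ n) (\<lambda>_. 1) i / r ^ n) \<longlonglongrightarrow> c * v i"
    using iterates(1) by blast
  \<comment> \<open>The normalised iterates converge to a multiple of \<open>v\<close>, so the limit
    at colour \<open>j\<close> is \<open>c * v j\<close>.\<close>
  show "\<exists>c>0. (\<lambda>n. 1 / r ^ n *
      (MIN Ds \<in> {Ds. set Ds \<subseteq> path_matrices E \<and> length Ds = n}. product_norm E j Ds)) \<longlonglongrightarrow> c"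
    using c(1) c(2)[OF j_in_S] v[OF j_in_S]
    by (intro exI[of _ "c * v j"]) (simp add: Min_product_norm)
  \<comment> \<open>The iterate lies below every product norm, so its uniform lower bound holds for
    all sequences of factors.\<close>
  obtain c' where c': "c' > 0" "\<And>n i. i \<in> S \<Longrightarrow> c' * r ^ n \<le> (min_step ^^ n) (\<lambda>_. 1) i"
    using iterates(2) by blast
  show "\<exists>c>0. \<forall>n. \<forall>Ds. set Ds \<subseteq> path_matrices E \<and> length Ds = n \<longrightarrow>
      product_norm E j Ds \<ge> c * r ^ n"
  proof (intro exI[of _ c'] conjI allI impI)
    fix n Ds assume "set Ds \<subseteq> path_matrices E \<and> length Ds = n"
    thus "product_norm E j Ds \<ge> c' * r ^ n"
      using c'(2)[OF j_in_S, of n] min_step_iterate_le_product_norm[OF _ j_in_S, of Ds] by auto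
  qed (rule c'(1))
qed

end

theorem theorem3p1:
  fixes E :: "('v, 'e) edge_system" and \<iota> :: nat
  assumes "eigs E"
    and "\<iota> < ncolours E"
    and "primitive_frobenius (mass_matrix E)"
    and "\<forall>D \<in> path_matrices E. primitive_frobenius D"
    and "locally_primitive_stable E \<iota>"
  shows "\<forall>j \<in> reachable_from (mass_matrix E) \<iota>.
    (\<exists>c > 0. (\<lambda>n. 1 / distance_rate E j ^ n *
        (MIN Ds \<in> {Ds. set Ds \<subseteq> path_matrices E \<and> length Ds = n}. product_norm E j Ds))
      \<longlonglongrightarrow> c) \<and>
    (\<exists>c > 0. \<forall>n. \<forall>Ds. set Ds \<subseteq> path_matrices E \<and> length Ds = n \<longrightarrow>
        product_norm E j Ds \<ge> c * distance_rate E j ^ n)"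
proof
  fix j assume j: "j \<in> reachable_from (mass_matrix E) \<iota>"
  hence "j < ncolours E" by (simp add: reachable_from_def mass_matrix_def)
  moreover obtain X where "X \<in> path_matrices E"
    "spec_rad (principal_submatrix X (support_set E j)) = distance_rate E j"
    "primitive_mat (principal_submatrix X (support_set E j))"
    "\<forall>i \<in> support_set E j. \<forall>Y \<in> path_matrices E.
      primitive_mat (principal_submatrix (replace_row X i Y) (support_set E j))"
    using assms(5) j unfolding locally_primitive_stable_def by blast
  ultimately have "stable_colour E j X"
    using assms(1) by (intro stable_colour.intro stable_colour_axioms.intro) auto
  thus "(\<exists>c > 0. (\<lambda>n. 1 / distance_rate E j ^ n *
        (MIN Ds \<in> {Ds. set Ds \<subseteq> path_matrices E \<and> length Ds = n}. product_norm E j Ds))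
      \<longlonglongrightarrow> c) \<and>
    (\<exists>c > 0. \<forall>n. \<forall>Ds. set Ds \<subseteq> path_matrices E \<and> length Ds = n \<longrightarrow>
        product_norm E j Ds \<ge> c * distance_rate E j ^ n)"
    by (intro conjI stable_colour.minimal_products)
qed

end
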